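(* Let $X$ be a nonzero complex Banach space with open unit ball $\mathbb{B}$, let $0\le\alpha<1$, and let $F:\mathbb{B}\to X$ be a locally biholomorphic mapping satisfying $$\frac{D^{k+1}F(0)(x^{k+1})}{(k+1)!}=H_{F,k}(x)\,x,\qquad x\in X,\quad k=1,2,3,$$ where each $H_{F,k}$ is a homogeneous polynomial of degree $k$ on $X$ with values in $\mathbb{C}$. If $F\in\mathcal{S}^*_{\mathbb{B}}(\alpha)$, then for every $x_0\in X$ with $\|x_0\|=1$ and every $T_{x_0}\in T(x_0)$, $$|H_{2,1}(F)|=|A_3-A_2^2|\le 1-\alpha .$$ Moreover, the estimate is sharp: for every nonzero complex Banach space $X$ and every $0\le\alpha<1$ there are a locally biholomorphic mapping $F\in\mathcal{S}^*_{\mathbb{B}}(\alpha)$ with $\frac{D^{k+1}F(0)(x^{k+1})}{(k+1)!}=H_{F,k}(x)\,x$ for all $x\in X$ and $k=1,2,3$, where each $H_{F,k}$ is a $\mathbb{C}$-valued homogeneous polynomial of degree $k$ on $X$, a unit vector $x_0$ and $T_{x_0}\in T(x_0)$ for which equality $|A_3-A_2^2|=1-\alpha$ holds.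
   Context: $X$ is a complex Banach space with norm $\|\cdot\|$ and $\mathbb{B}=\{x\in X:\|x\|<1\}$. For $x\in X\setminus\{0\}$, $T(x)$ is the (nonempty) set of bounded linear functionals $T_x:X\to\mathbb{C}$ with $\|T_x\|=1$ and $T_x(x)=\|x\|$. For holomorphic $F:\mathbb{B}\to X$, $DF(x)$ is the Fréchet derivative at $x$, $D^nF(x)$ is the $n$th Fréchet derivative (a bounded symmetric $n$-linear map $X^n\to X$), and $D^nF(0)(x^n)=D^nF(0)(x,\ldots,x)$. $F$ is normalized if $F(0)=0$ and $DF(0)=I$ (the identity), and locally biholomorphic if it is holomorphic and $DF(x)$ is invertible with bounded inverse for every $x\in\mathbb{B}$. Class $\mathcal{S}^*_{\mathbb{B}}(\alpha)$ (starlike mappings of order $\alpha$): for $0<\alpha<1$, the set of normalized locally biholomorphic $F:\mathbb{B}\to X$ such that $$\left|\frac{1}{\|x\|}T_x\big((DF(x))^{-1}F(x)\big)-\frac{1}{2\alpha}\right|<\frac{1}{2\alpha}\quad\text{for all }x\in\mathbb{B}\setminus\{0\},\ T_x\in T(x);$$ equivalently, $\operatorname{Re}\big(\|x\|/T_x((DF(x))^{-1}F(x))\big)>\alpha$ for all such $x,T_x$. For $\alpha=0$, $\mathcal{S}^*_{\mathbb{B}}(0)=\mathcal{S}^*_{\mathbb{B}}$ is the set of normalized locally biholomorphic $F$ with $\operatorname{Re}\,T_x((DF(x))^{-1}F(x))>0$ for all $x\in\mathbb{B}\setminus\{0\}$, $T_x\in T(x)$. Given $x_0$ with $\|x_0\|=1$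 and $T_{x_0}\in T(x_0)$, put $A_n=\frac{1}{n!}T_{x_0}\big(D^nF(0)(x_0^n)\big)$ for $n=2,3$. *)

theory Defs
  imports "HOL-Analysis.Analysis"
begin

(* The distribution has no class of complex normed spaces.  The underlying real Banach space
   is the one given by class banach; norm_scaleC makes the norm a complex norm. *)
class complex_banach = banach +
  fixes scaleC :: "complex \<Rightarrow> 'a \<Rightarrow> 'a"  (infixr \<open>*\<^sub>C\<close> 75)
  assumes scaleC_add_right: "c *\<^sub>C (x + y) = c *\<^sub>C x + c *\<^sub>C y"
    and scaleC_add_left: "(c + d) *\<^sub>C x = c *\<^sub>C x + d *\<^sub>C x"
    and scaleC_scaleC: "c *\<^sub>C d *\<^sub>C x = (c * d) *\<^sub>C x"
    and scaleC_one: "1 *\<^sub>C x = x"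
    and scaleR_scaleC: "r *\<^sub>R x = complex_of_real r *\<^sub>C x"
    and norm_scaleC: "norm (c *\<^sub>C x) = cmod c * norm x"

instantiation complex :: complex_banach
begin

definition scaleC_complex :: "complex \<Rightarrow> complex \<Rightarrow> complex"
  where "scaleC_complex c z = c * z"

instance
  by standard (auto simp: scaleC_complex_def algebra_simps norm_mult scaleR_conv_of_real)

end

definition complex_linear :: "('a::complex_banach \<Rightarrow> 'b::complex_banach) \<Rightarrow> bool"
  where "complex_linear f \<longleftrightarrow>
    (\<forall>x y. f (x + y) = f x + f y) \<and> (\<forall>c x. f (c *\<^sub>C x) = c *\<^sub>C f x)"

definition bounded_complex_linear :: "('a::complex_banach \<Rightarrow> 'b::complex_banach) \<Rightarrow> bool"
  where "bounded_complex_linear f \<longleftrightarrow> bounded_linear f \<and> complex_linear f"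

definition support_functionals :: "'a::complex_banach \<Rightarrow> ('a \<Rightarrow> complex) set"
  where "support_functionals x =
    {T. bounded_complex_linear T \<and> onorm T = 1 \<and> T x = complex_of_real (norm x)}"

(* FD F x is the Frechet derivative DF(x) as an element of the normed space of bounded operators.
   It is polymorphic in the codomain, so FD (FD F) is D^2 F with values in L(X, L(X, Y)), the
   bounded bilinear maps in curried form, and so on for higher orders.  For holomorphic F all
   derivatives are complex (multi)linear, although the type only records real linearity. *)
definition FD :: "('a::real_normed_vector \<Rightarrow> 'b::real_normed_vector) \<Rightarrow> 'a \<Rightarrow> 'a \<Rightarrow>\<^sub>L 'b"
  where "FD F x = Blinfun (frechet_derivative F (at x))"

lemma FD_works:
  assumes "F differentiable (at x)"
  shows "(F has_derivative blinfun_apply (FD F x)) (at x)"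
proof -
  have d: "(F has_derivative frechet_derivative F (at x)) (at x)"
    using assms frechet_derivative_works by blast
  then have "blinfun_apply (FD F x) = frechet_derivative F (at x)"
    unfolding FD_def by (intro bounded_linear_Blinfun_apply has_derivative_bounded_linear)
  with d show ?thesis by simp
qed

(* D2_diag F v = D^2 F(0)(v^2), and similarly for orders 3 and 4. *)
definition D2_diag :: "('a::real_normed_vector \<Rightarrow> 'b::real_normed_vector) \<Rightarrow> 'a \<Rightarrow> 'b"
  where "D2_diag F v = blinfun_apply (blinfun_apply (FD (FD F) 0) v) v"

definition D3_diag :: "('a::real_normed_vector \<Rightarrow> 'b::real_normed_vector) \<Rightarrow> 'a \<Rightarrow> 'b"
  where "D3_diag F v = blinfun_apply (blinfun_apply (blinfun_apply (FD (FD (FD F)) 0) v) v) v"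

definition D4_diag :: "('a::real_normed_vector \<Rightarrow> 'b::real_normed_vector) \<Rightarrow> 'a \<Rightarrow> 'b"
  where "D4_diag F v =
    blinfun_apply (blinfun_apply (blinfun_apply (blinfun_apply (FD (FD (FD (FD F))) 0) v) v) v) v"

(* A mapping on the unit ball is a total function whose values off the ball play no role. *)
definition holomorphic_ball :: "('a::complex_banach \<Rightarrow> 'a) \<Rightarrow> bool"
  where "holomorphic_ball F \<longleftrightarrow>
    (\<forall>x\<in>ball 0 1. \<exists>D. bounded_complex_linear D \<and> (F has_derivative D) (at x))"

definition normalized :: "('a::complex_banach \<Rightarrow> 'a) \<Rightarrow> bool"
  where "normalized F \<longleftrightarrow> F 0 = 0 \<and> FD F 0 = id_blinfun"

definition locally_biholomorphic :: "('a::complex_banach \<Rightarrow> 'a) \<Rightarrow> bool"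
  where "locally_biholomorphic F \<longleftrightarrow> holomorphic_ball F \<and>
    (\<forall>x\<in>ball 0 1. bij (blinfun_apply (FD F x)) \<and>
      bounded_linear (inv (blinfun_apply (FD F x))))"

definition starlike_mappings :: "real \<Rightarrow> ('a::complex_banach \<Rightarrow> 'a) set"
  where "starlike_mappings \<alpha> =
    {F. normalized F \<and> locally_biholomorphic F \<and>
      (\<forall>x\<in>ball 0 1 - {0}. \<forall>T\<in>support_functionals x.
        let w = T (inv (blinfun_apply (FD F x)) (F x)) in
        if \<alpha> = 0 then Re w > 0
        else cmod (1 / complex_of_real (norm x) * w - 1 / (2 * complex_of_real \<alpha>))
               < 1 / (2 * \<alpha>))}"

(* P is the diagonal of a k-linear form L; a k-tuple is a list of length k.
   Neither symmetry nor continuity of L is required: L can always be symmetrized, and a P with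
   P x *C x = D^(k+1) F(0)(x^(k+1)) / (k+1)! is bounded on the unit ball, hence continuous. *)
definition homogeneous_polynomial :: "nat \<Rightarrow> ('a::complex_banach \<Rightarrow> complex) \<Rightarrow> bool"
  where "homogeneous_polynomial k P \<longleftrightarrow>
    (\<exists>L :: 'a list \<Rightarrow> complex.
      (\<forall>xs ys. length xs + length ys + 1 = k \<longrightarrow> complex_linear (\<lambda>x. L (xs @ x # ys))) \<and>
      (\<forall>x. P x = L (replicate k x)))"

definition radial_terms :: "('a::complex_banach \<Rightarrow> 'a) \<Rightarrow> (nat \<Rightarrow> 'a \<Rightarrow> complex) \<Rightarrow> bool"
  where "radial_terms F H \<longleftrightarrow>
    (\<forall>k\<in>{1,2,3}. homogeneous_polynomial k (H k)) \<and>
    (\<forall>x. D2_diag F x /\<^sub>R fact 2 = H 1 x *\<^sub>C x \<and>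
         D3_diag F x /\<^sub>R fact 3 = H 2 x *\<^sub>C x \<and>
         D4_diag F x /\<^sub>R fact 4 = H 3 x *\<^sub>C x)"

definition A2 :: "('a::complex_banach \<Rightarrow> 'a) \<Rightarrow> 'a \<Rightarrow> ('a \<Rightarrow> complex) \<Rightarrow> complex"
  where "A2 F x0 T = 1 / fact 2 * T (D2_diag F x0)"

definition A3 :: "('a::complex_banach \<Rightarrow> 'a) \<Rightarrow> 'a \<Rightarrow> ('a \<Rightarrow> complex) \<Rightarrow> complex"
  where "A3 F x0 T = 1 / fact 3 * T (D3_diag F x0)"

end

theory Submission
  imports Defs "HOL-Complex_Analysis.Complex_Analysis"
begin

text \<open>
Fix a unit vector x0 with support functional T. The function h(z) = T (DF(z x0)^-1 F(z x0)) is
holomorphic on the unit disc, and starlikeness of order \<alpha> says that p(z) = h(z)/z takes values in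
the convex region Re w > \<alpha> |w|^2, because (cnj z / |z|) T is a support functional at z x0. The radial
form of the expansion of F gives h(z) = z + a z^2 + b z^3 + ... with b = -2 (A3 - A2^2). Passing to
the even part of p and mapping the region to the unit disc by w \<mapsto> (1 - w) / (1 + (1 - 2\<alpha>) w),
the Schwarz lemma gives |b| \<le> 2 (1 - \<alpha>). Equality holds for
F(x) = (1 - (T x)^2)^(\<alpha> - 1) x.

Holomorphy of h and the meaning of the higher derivatives at 0 rest on the fact that the derivative
of a complex Frechet differentiable map is again complex Frechet differentiable in operator norm.
This follows from Cauchy estimates for difference quotients of scalar functions, transferred to
vector values by the Hahn-Banach theorem, which also supplies the support functional needed for
sharpness.
\<close>

section \<open>Hahn-Banach theorem\<close>

text \<open>The radial form is what reduces the problem to one variable. With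
  \<open>b = H 1 x0\<close>, \<open>c = H 2 x0\<close> and f(t) = t + b t^2 + c t^3, it gives F(t
  x0) = f(t) x0 + o(t^3) and DF(t x0) x0 = f'(t) x0 + o(t^2), so DF(t x0)^-1 F(t x0) agrees with
  (f/f')(t) x0 up to o(t^3). As f/f' = t - b t^2 + (2 b^2 - 2 c) t^3 + ... and T x0 = 1 gives A2 = b
  and A3 = c, the third coefficient of h is -2 (A3 - A2^2). These expansions are obtained only for
  real t decreasing to 0, from a one-variable Taylor formula, whereas holomorphy of h on the disc
  has a separate proof. The two are matched at 0 by splitting off one coefficient after the
  other.\<close>

definition sublinear :: "('a::real_vector \<Rightarrow> real) \<Rightarrow> bool"
  where "sublinear p \<longleftrightarrow>
    (\<forall>x y. p (x + y) \<le> p x + p y) \<and> (\<forall>c x. 0 \<le> c \<longrightarrow> p (c *\<^sub>R x) = c * p x)"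

lemma sublinear_add: "sublinear p \<Longrightarrow> p (x + y) \<le> p x + p y"
  and sublinear_scale: "sublinear p \<Longrightarrow> 0 \<le> c \<Longrightarrow> p (c *\<^sub>R x) = c * p x"
  by (auto simp: sublinear_def)

lemma sublinear_zero: "sublinear p \<Longrightarrow> p 0 = 0"
  using sublinear_scale[of p 0 0] by simp

lemma sublinear_minus: "sublinear p \<Longrightarrow> - p (- x) \<le> p x"
  using sublinear_add[of p x "- x"] sublinear_zero[of p] by simp

text \<open>Tool for the minimality argument: taking t = 1 in the infimum makes
  \<open>q (- a)\<close> small, so a sublinear p that cannot be lowered satisfies p(-a) \<le> -p(a)
  and is odd. Subadditivity bounds every competitor below by -p(-x), so the infimum is
  finite.\<close>

lemma sublinear_shrink:
  fixes p :: "'a::real_vector \<Rightarrow> real"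
  assumes p: "sublinear p"
  obtains q where "sublinear q" "\<And>x. q x \<le> p x" "q (- a) \<le> - p a"
proof -
  define g where "g x t = p (x + t *\<^sub>R a) - t * p a" for x t
  define q where "q x = (INF t\<in>{0..}. g x t)" for x
  have lb: "- p (- x) \<le> g x t" if "0 \<le> t" for x t
    using sublinear_add[OF p, of "x + t *\<^sub>R a" "- x"] sublinear_scale[OF p that, of a]
    by (simp add: g_def)
  have bdd: "bdd_below (g x ` {0..})" for x
    using lb by (auto intro!: bdd_belowI2)
  have le: "q x \<le> g x t" if "0 \<le> t" for x t
    unfolding q_def using bdd that by (auto intro: cINF_lower)
  have ge: "z \<le> q x" if "\<And>t. 0 \<le> t \<Longrightarrow> z \<le> g x t" for x z
    unfolding q_def using that by (intro cINF_greatest) auto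
  have add: "q (x + y) \<le> q x + q y" for x y
  proof -
    have "q (x + y) \<le> g x t + g y s" if "0 \<le> t" "0 \<le> s" for t s
    proof -
      have "q (x + y) \<le> g (x + y) (t + s)"
        using that by (intro le) auto
      also have "\<dots> \<le> g x t + g y s"
        using sublinear_add[OF p, of "x + t *\<^sub>R a" "y + s *\<^sub>R a"]
        by (simp add: g_def algebra_simps)
      finally show ?thesis .
    qed
    then have "q (x + y) - g x t \<le> q y" if "0 \<le> t" for t
      using that by (intro ge) (simp add: diff_le_eq add.commute)
    then have "q (x + y) - q y \<le> q x"
      by (intro ge) (simp add: algebra_simps)
    then show ?thesis by simp
  qed
  \<comment> \<open>One inequality suffices: applied to 1/c and the vector c x it yields the
    other.\<close>
  have half: "q (c *\<^sub>R x) \<le> c * q x" if "0 < c" for c x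
  proof -
    have "q (c *\<^sub>R x) / c \<le> g x t" if "0 \<le> t" for t
    proof -
      have "q (c *\<^sub>R x) \<le> g (c *\<^sub>R x) (c * t)"
        using that \<open>0 < c\<close> by (intro le) auto
      also have "\<dots> = c * g x t"
        using sublinear_scale[OF p, of c "x + t *\<^sub>R a"] \<open>0 < c\<close> by (simp add: g_def algebra_simps)
      finally show ?thesis using \<open>0 < c\<close> by (simp add: field_simps)
    qed
    then have "q (c *\<^sub>R x) / c \<le> q x" by (intro ge)
    then show ?thesis using that by (simp add: field_simps)
  qed
  have "q 0 = 0"
    using le[of 0 0] lb[of _ 0] by (intro antisym ge) (auto simp: g_def sublinear_zero[OF p] sublinear_scale[OF p])
  moreover have "q (c *\<^sub>R x) = c * q x" if "0 < c" for c x
    using half[OF that, of x] half[of "1 / c" "c *\<^sub>R x"] that by (simp add: field_simps)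
  ultimately have "q (c *\<^sub>R x) = c * q x" if "0 \<le> c" for c x
    using that by (cases "c = 0") auto
  with add have "sublinear q"
    by (auto simp: sublinear_def)
  moreover have "q x \<le> p x" for x
    using le[of 0 x] by (simp add: g_def)
  moreover have "q (- a) \<le> - p a"
    using le[of 1 "- a"] by (simp add: g_def sublinear_zero[OF p])
  ultimately show thesis by (rule that)
qed

text \<open>The linear functionals are exactly the minimal sublinear functionals, which makes it possible
  to apply Zorn's lemma to functionals defined on the whole space.\<close>

lemma hahn_banach_sublinear:
  fixes p :: "'a::real_vector \<Rightarrow> real"
  assumes p: "sublinear p"
  obtains f where "linear f" "\<And>x. f x \<le> p x" "f a = p a"
proof -
  \<comment> \<open>The prescribed value at a is built into the starting point: everything below
    \<open>p0\<close> is at most -p(a) at -a, so a linear functional below \<open>p0\<close> takes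
    the value p(a) at a.\<close>
  obtain p0 where p0: "sublinear p0" "\<And>x. p0 x \<le> p x" "p0 (- a) \<le> - p a"
    using sublinear_shrink[OF p, of a] by blast
  define A where "A = {q. sublinear q \<and> (\<forall>x. q x \<le> p0 x)}"
  \<comment> \<open>\<open>P\<close> is the reversed pointwise order, so upper bounds of chains are
    infima and Zorn's maximal element is a minimal functional.\<close>
  define P where "P = (\<lambda>q r. \<forall>x. (r::'a\<Rightarrow>real) x \<le> (q::'a\<Rightarrow>real) x)"
  have "\<exists>m\<in>A. \<forall>q\<in>A. P m q \<longrightarrow> q = m"
  proof (rule predicate_Zorn)
    show "partial_order_on A (relation_of P A)"
      by (rule partial_order_on_relation_ofI) (auto simp: P_def fun_eq_iff intro: order_trans antisym)
    fix C assume "C \<in> Chains (relation_of P A)"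
    then have C: "C \<subseteq> A" and chain: "\<And>q r. q \<in> C \<Longrightarrow> r \<in> C \<Longrightarrow> P q r \<or> P r q"
      by (auto simp: Chains_def relation_of_def)
    show "\<exists>u\<in>A. \<forall>q\<in>C. P q u"
    proof (cases "C = {}")
      case True
      then show ?thesis using p0 by (auto simp: A_def)
    next
      case False
      define u where "u x = (INF q\<in>C. q x)" for x
      have lb: "- p0 (- x) \<le> q x" if "q \<in> C" for q x
      proof -
        have "sublinear q" "q (- x) \<le> p0 (- x)" using C that by (auto simp: A_def)
        then show ?thesis using sublinear_minus[of q x] by linarith
      qed
      have bdd: "bdd_below ((\<lambda>q. q x) ` C)" for x
        using lb by (auto intro!: bdd_belowI2)
      have le: "u x \<le> q x" if "q \<in> C" for q x
        unfolding u_def using bdd that by (auto intro: cINF_lower)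
      have ge: "z \<le> u x" if "\<And>q. q \<in> C \<Longrightarrow> z \<le> q x" for x z
        unfolding u_def using that False by (intro cINF_greatest) auto
      have add: "u (x + y) \<le> u x + u y" for x y
      proof -
        have qr: "u (x + y) \<le> q x + r y" if qr: "q \<in> C" "r \<in> C" for q r
        proof -
          obtain s where s: "s \<in> C" "s x \<le> q x" "s y \<le> r y"
            using chain[OF qr] qr unfolding P_def by blast
          have "u (x + y) \<le> s (x + y)" using le s by blast
          also have "\<dots> \<le> s x + s y" using s C by (auto simp: A_def intro: sublinear_add)
          finally show ?thesis using s by linarith
        qed
        have "u (x + y) - q x \<le> u y" if "q \<in> C" for q
        proof (rule ge)
          show "u (x + y) - q x \<le> r y" if "r \<in> C" for r
            using qr[OF \<open>q \<in> C\<close> that] by simp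
        qed
        then have "u (x + y) - u y \<le> u x"
          by (intro ge) (simp add: algebra_simps)
        then show ?thesis by simp
      qed
      have half: "u (c *\<^sub>R x) \<le> c * u x" if "0 < c" for c x
      proof -
        have "u (c *\<^sub>R x) / c \<le> q x" if "q \<in> C" for q
          using le[OF that, of "c *\<^sub>R x"] that C \<open>0 < c\<close>
          by (auto simp: A_def sublinear_scale field_simps)
        then have "u (c *\<^sub>R x) / c \<le> u x" by (intro ge)
        then show ?thesis using that by (simp add: field_simps)
      qed
      have "u 0 = 0"
      proof -
        have "q 0 = 0" if "q \<in> C" for q using C that by (auto simp: A_def sublinear_zero)
        then have "(\<lambda>q. q 0) ` C = {0}" using False by force
        then show ?thesis by (simp add: u_def)
      qed
      moreover have "u (c *\<^sub>R x) = c * u x" if "0 < c" for c x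
        using half[OF that, of x] half[of "1 / c" "c *\<^sub>R x"] that by (simp add: field_simps)
      ultimately have "u (c *\<^sub>R x) = c * u x" if "0 \<le> c" for c x
        using that by (cases "c = 0") auto
      with add have "sublinear u"
        by (auto simp: sublinear_def)
      moreover have "u x \<le> p0 x" for x
      proof -
        obtain q where "q \<in> C" using False by blast
        then have "u x \<le> q x" "q x \<le> p0 x" using le C by (auto simp: A_def)
        then show ?thesis by simp
      qed
      ultimately have "u \<in> A" by (auto simp: A_def)
      then show ?thesis using le by (auto simp: P_def)
    qed
  qed
  then obtain m where mA: "m \<in> A" and max: "\<And>q. q \<in> A \<Longrightarrow> P m q \<Longrightarrow> q = m"
    by blast
  then have m: "sublinear m" "\<And>x. m x \<le> p0 x"
    by (auto simp: A_def)
  have min: "q = m" if "sublinear q" "\<And>x. q x \<le> m x" for q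
  proof (rule max)
    show "q \<in> A" using that m(2) order_trans unfolding A_def by blast
    show "P m q" using that by (simp add: P_def)
  qed
  \<comment> \<open>By minimality the functional shrunk at b is m itself, so m is odd; an odd
    sublinear functional is linear.\<close>
  have minus: "m (- b) = - m b" for b
  proof -
    obtain q where q: "sublinear q" "\<And>x. q x \<le> m x" "q (- b) \<le> - m b"
      using sublinear_shrink[OF m(1), of b] by blast
    with min[of q] show ?thesis using sublinear_minus[OF m(1), of "b"] by simp
  qed
  have "m (x + y) = m x + m y" for x y
    using sublinear_add[OF m(1), of x y] sublinear_add[OF m(1), of "x + y" "- y"] minus[of y] by simp
  moreover have "m (c *\<^sub>R x) = c * m x" for c x
    using sublinear_scale[OF m(1), of c x] sublinear_scale[OF m(1), of "- c" x] minus[of "c *\<^sub>R x"]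
    by (cases "0 \<le> c") auto
  ultimately have "linear m" by (auto intro!: linearI)
  moreover have "m x \<le> p x" for x
    using m p0 order_trans by blast
  moreover have "m a = p a"
    using m(2)[of "- a"] p0(3) minus[of a] calculation(2)[of a] by linarith
  ultimately show thesis by (rule that)
qed

section \<open>Complex scalar multiplication and support functionals\<close>

lemma scaleC_zero [simp]: "0 *\<^sub>C (x::'a::complex_banach) = 0"
  by (metis norm_eq_zero norm_scaleC norm_zero mult_zero_left)

lemma scaleC_zero_right [simp]: "c *\<^sub>C (0::'a::complex_banach) = 0"
  by (metis norm_eq_zero norm_scaleC norm_zero mult_zero_right)

lemma scaleC_minus_right [simp]: "c *\<^sub>C (- x::'a::complex_banach) = - (c *\<^sub>C x)"
  using scaleC_add_right[of c x "- x"] by (simp add: eq_neg_iff_add_eq_0 add.commute)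

lemma scaleC_minus_left [simp]: "(- c) *\<^sub>C (x::'a::complex_banach) = - (c *\<^sub>C x)"
  using scaleC_add_left[of c "- c" x] by (simp add: eq_neg_iff_add_eq_0 add.commute)

lemma scaleC_diff_right: "c *\<^sub>C (x - y::'a::complex_banach) = c *\<^sub>C x - c *\<^sub>C y"
  using scaleC_add_right[of c x "- y"] by simp

lemma scaleC_diff_left: "(c - d) *\<^sub>C (x::'a::complex_banach) = c *\<^sub>C x - d *\<^sub>C x"
  using scaleC_add_left[of c "- d" x] by simp

lemma scaleR_scaleC_commute: "r *\<^sub>R c *\<^sub>C (x::'a::complex_banach) = c *\<^sub>C r *\<^sub>R x"
  by (simp add: scaleR_scaleC scaleC_scaleC mult.commute)

lemma scaleC_complex_simp [simp]: "c *\<^sub>C (z::complex) = c * z"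
  by (simp add: scaleC_complex_def)

declare scaleC_one [simp] norm_scaleC [simp] scaleC_scaleC [simp]

lemma bounded_bilinear_scaleC: "bounded_bilinear (scaleC :: complex \<Rightarrow> 'a \<Rightarrow> 'a::complex_banach)"
proof
  show "(r *\<^sub>R c) *\<^sub>C x = r *\<^sub>R c *\<^sub>C x" for r c and x :: 'a
    by (simp add: scaleR_scaleC scaleR_conv_of_real)
  show "\<exists>K. \<forall>a (b::'a). norm (a *\<^sub>C b) \<le> norm a * norm b * K"
    by (rule exI[of _ 1]) simp
qed (auto simp: scaleC_add_left scaleC_add_right scaleR_scaleC_commute)

lemmas bounded_linear_scaleC_right = bounded_bilinear.bounded_linear_right[OF bounded_bilinear_scaleC]
lemmas bounded_linear_scaleC_left = bounded_bilinear.bounded_linear_left[OF bounded_bilinear_scaleC]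
lemmas tendsto_scaleC [tendsto_intros] = bounded_bilinear.tendsto[OF bounded_bilinear_scaleC]

text \<open>A real linear f is the real part of exactly one complex linear functional, x -> f(x) - i
  f(i x). Rotating x by a unimodular scalar makes its value real and nonnegative, which turns f
  \<le> norm into a bound of the modulus. At a the real part already exhausts that bound, so the
  imaginary part vanishes.\<close>

lemma support_functionals_nonempty:
  fixes a :: "'a::complex_banach"
  assumes "a \<noteq> 0"
  obtains T where "T \<in> support_functionals a"
proof -
  have "sublinear (norm :: 'a \<Rightarrow> real)"
    by (auto simp: sublinear_def norm_triangle_ineq)
  then obtain f where f: "linear f" "\<And>x. f x \<le> norm x" "f a = norm a"
    using hahn_banach_sublinear by metis
  define T where "T x = Complex (f x) (- f (\<i> *\<^sub>C x))" for x
  have add: "T (x + y) = T x + T y" for x y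
    by (simp add: T_def scaleC_add_right linear_add[OF f(1)] complex_eq_iff)
  have scale: "T (c *\<^sub>C x) = c * T x" for c x
  proof -
    have c: "c *\<^sub>C y = Re c *\<^sub>R y + Im c *\<^sub>R \<i> *\<^sub>C y" for y :: 'a
      unfolding scaleR_scaleC scaleC_scaleC scaleC_add_left[symmetric]
      by (simp add: complex_eq[symmetric] mult.commute)
    have "\<i> *\<^sub>C \<i> *\<^sub>C x = - x" by simp
    then show ?thesis
      by (simp add: T_def c[of x] c[of "\<i> *\<^sub>C x"] scaleC_add_right scaleR_scaleC_commute[symmetric]
          linear_add[OF f(1)] linear_scale[OF f(1)] linear_neg[OF f(1)] linear_diff[OF f(1)] complex_eq_iff)
  qed
  have ReT: "Re (T x) = f x" for x by (simp add: T_def)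
  have bd: "cmod (T x) \<le> norm x" for x
  proof (cases "T x = 0")
    case False
    define c where "c = cnj (T x) / cmod (T x)"
    have [simp]: "cmod c = 1" using False by (simp add: c_def norm_divide)
    have "c * T x = (T x * cnj (T x)) / cmod (T x)" by (simp add: c_def)
    also have "\<dots> = cmod (T x)"
      unfolding complex_norm_square[symmetric] using False by (simp add: power2_eq_square)
    finally have "cmod (T x) = Re (c * T x)" by simp
    also have "\<dots> = f (c *\<^sub>C x)" by (metis scale ReT)
    also have "\<dots> \<le> norm x" using f(2)[of "c *\<^sub>C x"] by simp
    finally show ?thesis .
  qed simp
  have bl: "bounded_linear T"
    by (rule bounded_linear_intro[of _ 1]) (auto simp: add scaleR_scaleC scale scaleR_conv_of_real bd)
  have "T a = norm a"
  proof -
    have "Re (T a) = norm a" by (simp add: T_def f)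
    moreover from this have "Im (T a) = 0"
      using power_mono[OF bd[of a], of 2] by (simp add: cmod_power2)
    ultimately show ?thesis by (simp add: complex_eq_iff)
  qed
  moreover have "onorm T = 1"
  proof (rule antisym)
    show "onorm T \<le> 1" by (rule onorm_bound) (auto simp: bd)
    show "1 \<le> onorm T"
      using onorm[OF bl, of a] \<open>T a = norm a\<close> assms by simp
  qed
  ultimately have "T \<in> support_functionals a"
    by (auto simp: support_functionals_def bounded_complex_linear_def complex_linear_def bl add scale)
  then show thesis by (rule that)
qed

section \<open>Cauchy estimates for difference quotients\<close>

text \<open>Since \<open>FD F\<close> takes values in an operator space, complex differentiability
  of \<open>FD F\<close>, and of its own derivatives in turn, makes sense once operator spaces are
  complex Banach spaces too. Scalars act on the values, which is meaningful for the real linear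
  operators of this type.\<close>

instantiation blinfun :: (complex_banach, complex_banach) complex_banach
begin

definition scaleC_blinfun :: "complex \<Rightarrow> ('a \<Rightarrow>\<^sub>L 'b) \<Rightarrow> ('a \<Rightarrow>\<^sub>L 'b)"
  where "scaleC_blinfun c A = Blinfun (\<lambda>x. c *\<^sub>C blinfun_apply A x)"

lemma blinfun_apply_scaleC [simp]:
  "blinfun_apply (c *\<^sub>C (A :: 'a \<Rightarrow>\<^sub>L 'b)) x = c *\<^sub>C blinfun_apply A x"
proof -
  have "bounded_linear (\<lambda>x. c *\<^sub>C blinfun_apply A x)"
    by (intro bounded_linear_compose[OF bounded_linear_scaleC_right]
        blinfun.bounded_linear_right)
  then show ?thesis
    by (simp add: scaleC_blinfun_def bounded_linear_Blinfun_apply)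
qed

instance
proof
  fix c d :: complex and A B :: "'a \<Rightarrow>\<^sub>L 'b" and r :: real
  show "c *\<^sub>C (A + B) = c *\<^sub>C A + c *\<^sub>C B"
    by (rule blinfun_eqI) (simp add: blinfun.add_left scaleC_add_right)
  show "(c + d) *\<^sub>C A = c *\<^sub>C A + d *\<^sub>C A"
    by (rule blinfun_eqI) (simp add: blinfun.add_left scaleC_add_left)
  show "c *\<^sub>C d *\<^sub>C A = (c * d) *\<^sub>C A"
    by (rule blinfun_eqI) simp
  show "1 *\<^sub>C A = A"
    by (rule blinfun_eqI) simp
  show "r *\<^sub>R A = complex_of_real r *\<^sub>C A"
    by (rule blinfun_eqI) (simp add: blinfun.scaleR_left scaleR_scaleC)
  have le: "norm (c *\<^sub>C A) \<le> cmod c * norm A" for c and A :: "'a \<Rightarrow>\<^sub>L 'b"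
  proof (rule norm_blinfun_bound)
    show "norm (blinfun_apply (c *\<^sub>C A) x) \<le> cmod c * norm A * norm x" for x
      using mult_left_mono[OF norm_blinfun[of A x], of "cmod c"] by (simp add: mult.assoc)
  qed simp
  show "norm (c *\<^sub>C A) = cmod c * norm A"
  proof (cases "c = 0")
    case True
    have "(0::complex) *\<^sub>C A = 0" by (rule blinfun_eqI) simp
    with True show ?thesis by simp
  next
    case False
    have "inverse c *\<^sub>C c *\<^sub>C A = A"
      by (rule blinfun_eqI) (simp add: False)
    then have "norm A \<le> inverse (cmod c) * norm (c *\<^sub>C A)"
      using le[of "inverse c" "c *\<^sub>C A"] by (simp add: norm_inverse)
    then have "cmod c * norm A \<le> norm (c *\<^sub>C A)"
      using False by (simp add: field_simps)
    with le show ?thesis by (meson antisym)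
  qed
qed

end

text \<open>The condition of \<open>holomorphic_ball\<close> with domain, codomain and set freed, so
  that it can be stated for \<open>FD F\<close>, for its iterates and for functions of one complex
  variable.\<close>

definition cdiff_on :: "('a::complex_banach \<Rightarrow> 'b::complex_banach) \<Rightarrow> 'a set \<Rightarrow> bool"
  where "cdiff_on F S \<longleftrightarrow>
    (\<forall>x\<in>S. \<exists>D. bounded_complex_linear D \<and> (F has_derivative D) (at x))"

lemma cdiff_onI:
  "(\<And>x. x \<in> S \<Longrightarrow> (F has_derivative D x) (at x)) \<Longrightarrow>
   (\<And>x c v. x \<in> S \<Longrightarrow> D x (c *\<^sub>C v) = c *\<^sub>C D x v) \<Longrightarrow> cdiff_on F S"
  unfolding cdiff_on_def bounded_complex_linear_def complex_linear_def
  by (meson has_derivative_bounded_linear linear_add bounded_linear.linear)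

lemma cdiff_on_FD:
  assumes "cdiff_on F S" "x \<in> S"
  shows "(F has_derivative blinfun_apply (FD F x)) (at x)"
    and "blinfun_apply (FD F x) (c *\<^sub>C v) = c *\<^sub>C blinfun_apply (FD F x) v"
proof -
  obtain D where D: "bounded_complex_linear D" "(F has_derivative D) (at x)"
    using assms unfolding cdiff_on_def by blast
  then show *: "(F has_derivative blinfun_apply (FD F x)) (at x)"
    by (intro FD_works) (auto simp: differentiable_def)
  then have "blinfun_apply (FD F x) = D"
    using D has_derivative_unique by blast
  with D show "blinfun_apply (FD F x) (c *\<^sub>C v) = c *\<^sub>C blinfun_apply (FD F x) v"
    by (simp add: bounded_complex_linear_def complex_linear_def)
qed

lemma cdiff_on_subset: "cdiff_on F S \<Longrightarrow> U \<subseteq> S \<Longrightarrow> cdiff_on F U"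
  by (auto simp: cdiff_on_def)

lemma cdiff_on_imp_continuous_on: "cdiff_on F S \<Longrightarrow> continuous_on S F"
  unfolding cdiff_on_def
  by (meson continuous_at_imp_continuous_on has_derivative_continuous)

lemma cdiff_on_holomorphic:
  fixes f :: "complex \<Rightarrow> complex"
  assumes "cdiff_on f S"
  shows "f holomorphic_on S"
proof -
  have "f field_differentiable (at z within S)" if "z \<in> S" for z
  proof -
    note d = cdiff_on_FD[OF assms that]
    have "blinfun_apply (FD f z) c = blinfun_apply (FD f z) 1 * c" for c
      using d(2)[of c 1] by simp
    then have "blinfun_apply (FD f z) = (*) (blinfun_apply (FD f z) 1)"
      by blast
    with d(1) show ?thesis
      by (metis field_differentiable_def has_field_derivative_def has_field_derivative_at_within)
  qed
  then show ?thesis by (simp add: holomorphic_on_def)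
qed

lemma bounded_complex_linearD:
  assumes "bounded_complex_linear T"
  shows "bounded_linear T" "T (x + y) = T x + T y" "T (x - y) = T x - T y"
    "T (c *\<^sub>C x) = c *\<^sub>C T x" "T (r *\<^sub>R x) = r *\<^sub>R T x" "T 0 = 0" "T (- x) = - T x"
  using assms unfolding bounded_complex_linear_def complex_linear_def
  by (auto simp: bounded_linear.linear linear_diff linear_scale linear_0 linear_neg)

lemma cdiff_on_compose_linear:
  assumes "cdiff_on f S" "bounded_complex_linear T"
  shows "cdiff_on (\<lambda>x. T (f x)) S"
proof (rule cdiff_onI)
  fix x assume "x \<in> S"
  note d = cdiff_on_FD[OF assms(1) this]
  show "((\<lambda>x. T (f x)) has_derivative (\<lambda>v. T (blinfun_apply (FD f x) v))) (at x)"
    by (rule bounded_linear.has_derivative[OF bounded_complex_linearD(1)[OF assms(2)] d(1)])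
  show "T (blinfun_apply (FD f x) (c *\<^sub>C v)) = c *\<^sub>C T (blinfun_apply (FD f x) v)" for c v
    by (simp add: d bounded_complex_linearD(4)[OF assms(2)])
qed

lemma cdiff_on_line:
  assumes F: "cdiff_on F S" and U: "\<And>s. s \<in> U \<Longrightarrow> a + s *\<^sub>C h \<in> S"
  shows "cdiff_on (\<lambda>s. F (a + s *\<^sub>C h)) U"
proof (rule cdiff_onI)
  fix s assume "s \<in> U"
  note d = cdiff_on_FD[OF F U[OF this]]
  have "((\<lambda>s. a + s *\<^sub>C h) has_derivative (\<lambda>s. s *\<^sub>C h)) (at s)"
    using has_derivative_add[OF has_derivative_const
        bounded_linear_imp_has_derivative[OF bounded_linear_scaleC_left]] by simp
  from has_derivative_compose[OF this d(1)]
  show "((\<lambda>s. F (a + s *\<^sub>C h)) has_derivative (\<lambda>t. blinfun_apply (FD F (a + s *\<^sub>C h)) (t *\<^sub>C h))) (at s)" .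
  show "blinfun_apply (FD F (a + s *\<^sub>C h)) ((c *\<^sub>C t) *\<^sub>C h) =
      c *\<^sub>C blinfun_apply (FD F (a + s *\<^sub>C h)) (t *\<^sub>C h)" for c t
    by (simp add: d(2)[symmetric])
qed

lemma cdiff_on_diff: "cdiff_on f S \<Longrightarrow> cdiff_on g S \<Longrightarrow> cdiff_on (\<lambda>x. f x - g x) S"
  by (rule cdiff_onI[where D = "\<lambda>x v. blinfun_apply (FD f x) v - blinfun_apply (FD g x) v"])
     (auto intro!: derivative_intros simp: cdiff_on_FD scaleC_diff_right)

lemma bounded_complex_linear_scaleC: "bounded_complex_linear (\<lambda>x. c *\<^sub>C x)"
  by (simp add: bounded_complex_linear_def complex_linear_def bounded_linear_scaleC_right
      scaleC_add_right mult.commute)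

text \<open>A support functional at y attains the norm of y, so estimates for scalar functions carry
  over to vector values with the same constant.\<close>

lemma norm_le_if_functionals_le:
  fixes y :: "'a::complex_banach"
  assumes "\<And>T. bounded_complex_linear T \<Longrightarrow> (\<And>x::'a. cmod (T x) \<le> norm x) \<Longrightarrow> cmod (T y) \<le> c"
    and "0 \<le> c"
  shows "norm y \<le> c"
proof (cases "y = 0")
  case False
  then obtain T where "T \<in> support_functionals y"
    using support_functionals_nonempty by blast
  then have T: "bounded_complex_linear T" "onorm T = 1" "T y = norm y"
    by (auto simp: support_functionals_def)
  have "cmod (T x) \<le> norm x" for x
    using onorm[OF bounded_complex_linearD(1)[OF T(1)], of x] T(2) by simp
  from assms(1)[OF T(1) this] show ?thesis by (simp add: T(3))
qed (use assms in simp)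

text \<open>The difference quotient q extends holomorphically across 0. On the circle of radius 3/2
  it is at most 2M/(3/2) = 4M/3, and the maximum principle carries this inward; Cauchy's inequality
  on discs of radius 1/2 about points of the unit disc then bounds q' by 8M/3. Both constants are
  rounded up to 4M.\<close>

lemma difference_quotient_bounds_complex:
  fixes f :: "complex \<Rightarrow> complex"
  assumes f: "f holomorphic_on ball 0 2" and M: "\<And>z. z \<in> ball 0 2 \<Longrightarrow> cmod (f z) \<le> M"
    and s: "cmod s \<le> 1" "s \<noteq> 0" and t: "cmod t \<le> 1" "t \<noteq> 0"
  shows "cmod ((f s - f 0) / s) \<le> 4 * M"
    and "cmod ((f s - f 0) / s - (f t - f 0) / t) \<le> 4 * M * cmod (s - t)"
proof -
  define q where "q z = (if z = 0 then deriv f 0 else (f z - f 0) / z)" for z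
  have "0 \<le> M" using M[of 0] norm_ge_zero[of "f 0"] by (simp del: norm_ge_zero)
  have df: "deriv (\<lambda>z. f z - f 0) 0 = deriv f 0"
    using f by (subst deriv_diff) (auto intro: holomorphic_on_imp_differentiable_at)
  have q: "q holomorphic_on ball 0 2"
    by (rule pole_theorem_open_0[of "\<lambda>z. f z - f 0" _ 0])
       (auto intro!: holomorphic_intros f simp: q_def df)
  have cq: "continuous_on (cball 0 (3/2)) q"
    by (rule continuous_on_subset[OF holomorphic_on_imp_continuous_on[OF q]]) auto
  have bd: "cmod (q z) \<le> 4 / 3 * M" if "cmod z \<le> 3 / 2" for z
  proof (rule maximum_modulus_frontier[of q "cball 0 (3/2)"])
    show "q holomorphic_on interior (cball 0 (3/2))"
      by (rule holomorphic_on_subset[OF q]) auto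
    fix w :: complex assume "w \<in> frontier (cball 0 (3/2))"
    then have w: "cmod w = 3 / 2" by simp
    then have "cmod (f w - f 0) \<le> 2 * M"
      using M[of w] M[of 0] norm_triangle_ineq4[of "f w" "f 0"] by simp
    moreover have "w \<noteq> 0" using w by auto
    ultimately show "cmod (q w) \<le> 4 / 3 * M"
      unfolding q_def by (simp add: norm_divide w del: divide_le_eq_numeral1)
  qed (use cq that in auto)
  have dq: "cmod (deriv q z) \<le> 4 * M" if "z \<in> cball 0 1" for z
  proof -
    have zw: "cmod w \<le> 3 / 2" if "cmod (z - w) \<le> 1 / 2" for w
      using norm_triangle_ineq3[of w z] that \<open>z \<in> cball 0 1\<close> by (simp add: norm_minus_commute)
    have sub: "cball z (1/2) \<subseteq> cball 0 (3/2)"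
      by (auto simp only: mem_cball dist_norm diff_0 norm_minus_cancel intro: zw)
    moreover have "cball 0 (3/2) \<subseteq> ball (0::complex) 2" by auto
    ultimately have sub2: "ball z (1/2) \<subseteq> ball 0 2" using ball_subset_cball by blast
    have "cmod ((deriv ^^ 1) q z) \<le> fact 1 * (4 / 3 * M) / (1/2) ^ 1"
    proof (rule Cauchy_inequality)
      show "continuous_on (cball z (1/2)) q"
        by (rule continuous_on_subset[OF cq sub])
      show "q holomorphic_on ball z (1/2)"
        by (rule holomorphic_on_subset[OF q sub2])
      show "cmod (q w) \<le> 4 / 3 * M" if "cmod (z - w) = 1 / 2" for w
        using zw that by (intro bd) simp
    qed simp
    with \<open>0 \<le> M\<close> show ?thesis by simp
  qed
  have "cmod (q s - q t) \<le> 4 * M * cmod (s - t)"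
  proof (rule field_differentiable_bound[of "cball 0 1" q "deriv q"])
    show "(q has_field_derivative deriv q z) (at z within cball 0 1)" if "z \<in> cball 0 1" for z
    proof -
      have "z \<in> ball 0 2" using that by simp
      then show ?thesis
        by (rule has_field_derivative_at_within[OF holomorphic_derivI[OF q open_ball]])
    qed
    show "convex (cball (0::complex) 1)" by (rule convex_cball)
    show "cmod (deriv q z) \<le> 4 * M" if "z \<in> cball 0 1" for z using dq that .
    show "s \<in> cball 0 1" "t \<in> cball 0 1" using s t by simp_all
  qed
  with s t show "cmod ((f s - f 0) / s - (f t - f 0) / t) \<le> 4 * M * cmod (s - t)"
    by (simp add: q_def)
  show "cmod ((f s - f 0) / s) \<le> 4 * M"
    using bd[of s] s \<open>0 \<le> M\<close> by (simp add: q_def)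
qed

lemma difference_quotient_bounds:
  fixes f :: "complex \<Rightarrow> 'b::complex_banach"
  assumes f: "cdiff_on f (ball 0 2)" and M: "\<And>z. z \<in> ball 0 2 \<Longrightarrow> norm (f z) \<le> M"
    and s: "cmod s \<le> 1" "s \<noteq> 0" and t: "cmod t \<le> 1" "t \<noteq> 0"
  shows "norm ((1 / s) *\<^sub>C (f s - f 0)) \<le> 4 * M"
    and "norm ((1 / s) *\<^sub>C (f s - f 0) - (1 / t) *\<^sub>C (f t - f 0)) \<le> 4 * M * cmod (s - t)"
proof -
  have "0 \<le> M" using M[of 0] norm_ge_zero[of "f 0"] by (simp del: norm_ge_zero)
  have *: "(\<lambda>z. T (f z)) holomorphic_on ball 0 2" if "bounded_complex_linear T" for T :: "'b \<Rightarrow> complex"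
    by (rule cdiff_on_holomorphic[OF cdiff_on_compose_linear[OF f that]])
  have b: "cmod (T (f z)) \<le> M" if "\<And>x. cmod (T x) \<le> norm x" "z \<in> ball 0 2" for T z
    using that M order_trans by blast
  show "norm ((1 / s) *\<^sub>C (f s - f 0)) \<le> 4 * M"
  proof (rule norm_le_if_functionals_le)
    fix T assume T: "bounded_complex_linear T" "\<And>x::'b. cmod (T x) \<le> norm x"
    from difference_quotient_bounds_complex(1)[OF * b, OF T(1) T(2), OF _ s t]
    show "cmod (T ((1 / s) *\<^sub>C (f s - f 0))) \<le> 4 * M"
      by (simp add: bounded_complex_linearD[OF T(1)])
  qed (use \<open>0 \<le> M\<close> in simp)
  show "norm ((1 / s) *\<^sub>C (f s - f 0) - (1 / t) *\<^sub>C (f t - f 0)) \<le> 4 * M * cmod (s - t)"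
  proof (rule norm_le_if_functionals_le)
    fix T assume T: "bounded_complex_linear T" "\<And>x::'b. cmod (T x) \<le> norm x"
    from difference_quotient_bounds_complex(2)[OF * b, OF T(1) T(2), OF _ s t]
    show "cmod (T ((1 / s) *\<^sub>C (f s - f 0) - (1 / t) *\<^sub>C (f t - f 0))) \<le> 4 * M * cmod (s - t)"
      by (simp add: bounded_complex_linearD[OF T(1)])
  qed (use \<open>0 \<le> M\<close> in simp)
qed

text \<open>The mixed difference quotient is Lipschitz in both increments; this is what makes
  second derivatives exist without any integration.\<close>

lemma mixed_difference_quotient_bounds:
  fixes \<Phi> :: "complex \<Rightarrow> complex \<Rightarrow> 'b::complex_banach"
  assumes f1: "\<And>t. t \<in> ball 0 2 \<Longrightarrow> cdiff_on (\<lambda>s. \<Phi> s t) (ball 0 2)"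
    and f2: "\<And>s. s \<in> ball 0 2 \<Longrightarrow> cdiff_on (\<lambda>t. \<Phi> s t) (ball 0 2)"
    and M: "\<And>s t. s \<in> ball 0 2 \<Longrightarrow> t \<in> ball 0 2 \<Longrightarrow> norm (\<Phi> s t) \<le> M"
  defines "\<Delta> \<equiv> \<lambda>s t. (1 / (s * t)) *\<^sub>C (\<Phi> s t - \<Phi> s 0 - \<Phi> 0 t + \<Phi> 0 0)"
  assumes s: "cmod s \<le> 1" "s \<noteq> 0" "cmod s' \<le> 1" "s' \<noteq> 0"
    and t: "cmod t \<le> 1" "t \<noteq> 0" "cmod t' \<le> 1" "t' \<noteq> 0"
  shows "norm (\<Delta> s t) \<le> 16 * M"
    and "norm (\<Delta> s t - \<Delta> s' t') \<le> 16 * M * (cmod (s - s') + cmod (t - t'))"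
proof -
  \<comment> \<open>Either variable may be differenced first: \<open>\<Delta>\<close> is the
    quotient in s of u and the quotient in t of w. Each differencing costs a factor 4, hence 16, and
    the Lipschitz bound goes through the intermediate point (s', t).\<close>
  define u where "u t s = (1 / t) *\<^sub>C (\<Phi> s t - \<Phi> s 0)" for t s
  define w where "w s t = (1 / s) *\<^sub>C (\<Phi> s t - \<Phi> 0 t)" for s t
  have du: "cdiff_on (u t) (ball 0 2)" if "cmod t \<le> 1" for t
    unfolding u_def using that
    by (intro cdiff_on_compose_linear[OF _ bounded_complex_linear_scaleC] cdiff_on_diff f1) auto
  have dw: "cdiff_on (w s) (ball 0 2)" if "cmod s \<le> 1" for s
    unfolding w_def using that
    by (intro cdiff_on_compose_linear[OF _ bounded_complex_linear_scaleC] cdiff_on_diff f2) auto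
  have bu: "norm (u t s) \<le> 4 * M" if "cmod t \<le> 1" "t \<noteq> 0" "s \<in> ball 0 2" for t s
    unfolding u_def by (rule difference_quotient_bounds(1)[of "\<Phi> s"]) (use that f2 M in auto)
  have bw: "norm (w s t) \<le> 4 * M" if "cmod s \<le> 1" "s \<noteq> 0" "t \<in> ball 0 2" for t s
    unfolding w_def by (rule difference_quotient_bounds(1)[of "\<lambda>s. \<Phi> s t"]) (use that f1 M in auto)
  have \<Delta>u: "\<Delta> s t = (1 / s) *\<^sub>C (u t s - u t 0)" for s t
    by (simp add: \<Delta>_def u_def scaleC_diff_right scaleC_add_right)
  have \<Delta>w: "\<Delta> s t = (1 / t) *\<^sub>C (w s t - w s 0)" for s t
    by (simp add: \<Delta>_def w_def scaleC_diff_right scaleC_add_right mult.commute)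
  show "norm (\<Delta> s t) \<le> 16 * M"
    unfolding \<Delta>u using difference_quotient_bounds(1)[OF du bu s] t by simp
  have "norm (\<Delta> s t - \<Delta> s' t) \<le> 16 * M * cmod (s - s')"
    unfolding \<Delta>u using difference_quotient_bounds(2)[OF du bu s] t by simp
  moreover have "norm (\<Delta> s' t - \<Delta> s' t') \<le> 16 * M * cmod (t - t')"
    unfolding \<Delta>w using difference_quotient_bounds(2)[OF dw bw t] s by simp
  ultimately show "norm (\<Delta> s t - \<Delta> s' t') \<le> 16 * M * (cmod (s - s') + cmod (t - t'))"
    using norm_triangle_ineq[of "\<Delta> s t - \<Delta> s' t" "\<Delta> s' t - \<Delta> s' t'"] by (simp add: algebra_simps)
qed

section \<open>Derivatives of holomorphic maps are holomorphic\<close>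

text \<open>Complex linearity of the derivative pulls the complex increment s out, so the quotient
  converges as s tends to 0 in the plane and not only along real s.\<close>

lemma tendsto_scaleC_at_0:
  fixes F :: "'a::complex_banach \<Rightarrow> 'b::complex_banach"
  assumes F: "cdiff_on F S" "x \<in> S"
  shows "((\<lambda>s. (1 / s) *\<^sub>C (F (x + s *\<^sub>C v) - F x)) \<longlongrightarrow> blinfun_apply (FD F x) v) (at 0)"
proof -
  have "cdiff_on (\<lambda>s. F (x + s *\<^sub>C v)) {0}"
    by (rule cdiff_on_line[OF F(1)]) (simp add: F(2))
  have g: "((\<lambda>s. x + s *\<^sub>C v) has_derivative (\<lambda>s. s *\<^sub>C v)) (at 0)"
    using has_derivative_add[OF has_derivative_const
        bounded_linear_imp_has_derivative[OF bounded_linear_scaleC_left]] by simp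
  have "(F has_derivative blinfun_apply (FD F x)) (at (x + 0 *\<^sub>C v))"
    using cdiff_on_FD(1)[OF F] by simp
  from has_derivative_compose[OF g this]
  have "((\<lambda>s. F (x + s *\<^sub>C v)) has_derivative (\<lambda>s. s *\<^sub>C blinfun_apply (FD F x) v)) (at 0)"
    by (simp add: cdiff_on_FD(2)[OF F])
  then have "((\<lambda>s. norm (F (x + s *\<^sub>C v) - F x - s *\<^sub>C blinfun_apply (FD F x) v) / cmod s) \<longlongrightarrow> 0) (at 0)"
    by (simp add: has_derivative_iff_norm)
  moreover have "norm ((1 / s) *\<^sub>C (F (x + s *\<^sub>C v) - F x) - blinfun_apply (FD F x) v)
      = norm (F (x + s *\<^sub>C v) - F x - s *\<^sub>C blinfun_apply (FD F x) v) / cmod s" if "s \<noteq> 0" for s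
  proof -
    have "(1 / s) *\<^sub>C (F (x + s *\<^sub>C v) - F x) - blinfun_apply (FD F x) v
        = (1 / s) *\<^sub>C (F (x + s *\<^sub>C v) - F x - s *\<^sub>C blinfun_apply (FD F x) v)"
      using that by (simp add: scaleC_diff_right)
    then show ?thesis by (simp add: norm_divide)
  qed
  ultimately have "((\<lambda>s. norm ((1 / s) *\<^sub>C (F (x + s *\<^sub>C v) - F x) - blinfun_apply (FD F x) v)) \<longlongrightarrow> 0) (at 0)"
    by (elim Lim_transform_eventually) (simp add: eventually_at_filter)
  then show ?thesis
    by (simp add: tendsto_norm_zero_iff LIM_zero_iff)
qed

section \<open>Second derivatives as limits of mixed difference quotients\<close>

locale ball_bounded_cdiff =
  fixes F :: "'a::complex_banach \<Rightarrow> 'b::complex_banach" and x :: 'a and r M :: real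
  assumes cdiff: "cdiff_on F (ball x (5 * r))"
    and bounded: "\<And>y. y \<in> ball x (5 * r) \<Longrightarrow> norm (F y) \<le> M"
    and r_pos: "0 < r"
begin

definition \<Delta> :: "'a \<Rightarrow> 'a \<Rightarrow> complex \<Rightarrow> complex \<Rightarrow> 'b"
  where "\<Delta> h v s t = (1 / (s * t)) *\<^sub>C
    (F (x + s *\<^sub>C h + t *\<^sub>C v) - F (x + s *\<^sub>C h) - F (x + t *\<^sub>C v) + F x)"

lemma \<Delta>_commute: "\<Delta> h v s t = \<Delta> v h t s"
  by (simp add: \<Delta>_def algebra_simps)

text \<open>Directions of norm at most r with parameters of modulus below 2 move x by at most 4r;
  the ball of radius 5r therefore contains the image of the whole bidisc of radius 2 on which the
  difference quotient estimates are formulated.\<close>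

lemma in_ball:
  assumes "norm h \<le> r" "norm v \<le> r" "cmod s < 2" "cmod t < 2"
  shows "x + s *\<^sub>C h + t *\<^sub>C v \<in> ball x (5 * r)"
proof -
  have "cmod s * norm h \<le> 2 * r" "cmod t * norm v \<le> 2 * r"
    using assms r_pos by (auto intro!: mult_mono)
  then have "norm (s *\<^sub>C h + t *\<^sub>C v) \<le> 4 * r"
    using norm_triangle_ineq[of "s *\<^sub>C h" "t *\<^sub>C v"] by simp
  also have "\<dots> < 5 * r" using r_pos by simp
  finally show ?thesis by (simp add: dist_norm norm_minus_commute ac_simps)
qed

lemma M_nonneg: "0 \<le> M"
  using bounded[of x] r_pos norm_ge_zero[of "F x"] by (simp del: norm_ge_zero)

lemma
  assumes hv: "norm h \<le> r" "norm v \<le> r"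
    and s: "cmod s \<le> 1" "s \<noteq> 0" "cmod s' \<le> 1" "s' \<noteq> 0"
    and t: "cmod t \<le> 1" "t \<noteq> 0" "cmod t' \<le> 1" "t' \<noteq> 0"
  shows \<Delta>_bound: "norm (\<Delta> h v s t) \<le> 16 * M"
    and \<Delta>_lipschitz: "norm (\<Delta> h v s t - \<Delta> h v s' t') \<le> 16 * M * (cmod (s - s') + cmod (t - t'))"
proof -
  have 1: "cdiff_on (\<lambda>s. F (x + s *\<^sub>C h + t *\<^sub>C v)) (ball 0 2)" if "t \<in> ball 0 2" for t
    using cdiff_on_line[OF cdiff, of "ball 0 2" "x + t *\<^sub>C v" h] in_ball[OF hv] that
    by (simp add: ac_simps)
  have 2: "cdiff_on (\<lambda>t. F (x + s *\<^sub>C h + t *\<^sub>C v)) (ball 0 2)" if "s \<in> ball 0 2" for s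
    using cdiff_on_line[OF cdiff, of "ball 0 2" "x + s *\<^sub>C h" v] in_ball[OF hv] that by simp
  have 3: "norm (F (x + s *\<^sub>C h + t *\<^sub>C v)) \<le> M" if "s \<in> ball 0 2" "t \<in> ball 0 2" for s t
    using that by (intro bounded in_ball hv) auto
  from mixed_difference_quotient_bounds[where \<Phi> = "\<lambda>s t. F (x + s *\<^sub>C h + t *\<^sub>C v)", OF 1 2 3 s t]
  show "norm (\<Delta> h v s t) \<le> 16 * M"
    and "norm (\<Delta> h v s t - \<Delta> h v s' t') \<le> 16 * M * (cmod (s - s') + cmod (t - t'))"
    by (simp_all add: \<Delta>_def)
qed

text \<open>Completeness enters here: the Lipschitz bound makes the values along s = t = 1/(n+1) a
  Cauchy sequence, and letting the second pair of arguments run along this sequence gives the rate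
  of convergence for arbitrary s and t.\<close>

lemma \<Delta>_limit_small:
  assumes hv: "norm h \<le> r" "norm v \<le> r"
  obtains B where "norm B \<le> 16 * M"
    "\<And>s t. cmod s \<le> 1 \<Longrightarrow> s \<noteq> 0 \<Longrightarrow> cmod t \<le> 1 \<Longrightarrow> t \<noteq> 0 \<Longrightarrow>
      norm (\<Delta> h v s t - B) \<le> 16 * M * (cmod s + cmod t)"
proof -
  define e :: "nat \<Rightarrow> complex" where "e n = complex_of_real (1 / Suc n)" for n
  have e: "cmod (e n) \<le> 1" "e n \<noteq> 0" for n
    by (simp_all add: e_def norm_divide del: of_nat_Suc)
  have e0: "e \<longlonglongrightarrow> 0"
    using tendsto_of_real[OF LIMSEQ_Suc[OF lim_1_over_n]] unfolding e_def of_real_0 .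
  have "Cauchy (\<lambda>n. \<Delta> h v (e n) (e n))"
  proof (rule metric_CauchyI)
    fix \<epsilon> :: real assume "0 < \<epsilon>"
    have "Cauchy e" using e0 by (simp add: LIMSEQ_imp_Cauchy)
    moreover have "0 < \<epsilon> / (32 * (M + 1))" using \<open>0 < \<epsilon>\<close> M_nonneg by simp
    ultimately obtain N where N: "\<And>m n. m \<ge> N \<Longrightarrow> n \<ge> N \<Longrightarrow> dist (e m) (e n) < \<epsilon> / (32 * (M + 1))"
      by (meson metric_CauchyD)
    have "dist (\<Delta> h v (e m) (e m)) (\<Delta> h v (e n) (e n)) < \<epsilon>" if "m \<ge> N" "n \<ge> N" for m n
    proof -
      have "dist (\<Delta> h v (e m) (e m)) (\<Delta> h v (e n) (e n)) \<le> 32 * (M + 1) * dist (e m) (e n)"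
        using \<Delta>_lipschitz[OF hv e[of m] e[of n] e[of m] e[of n]] 
        by (simp add: dist_norm algebra_simps add_increasing)
      also have "\<dots> < \<epsilon>"
        using N[OF that] M_nonneg by (simp add: field_simps)
      finally show ?thesis .
    qed
    then show "\<exists>N. \<forall>m\<ge>N. \<forall>n\<ge>N. dist (\<Delta> h v (e m) (e m)) (\<Delta> h v (e n) (e n)) < \<epsilon>"
      by blast
  qed
  then obtain B where B: "(\<lambda>n. \<Delta> h v (e n) (e n)) \<longlonglongrightarrow> B"
    using Cauchy_convergent convergent_def by blast
  show thesis
  proof (rule that)
    show "norm B \<le> 16 * M"
      by (rule LIMSEQ_le_const2[OF tendsto_norm[OF B]]) (use \<Delta>_bound[OF hv e e e e] in blast)
    fix s t assume st: "cmod s \<le> 1" "s \<noteq> 0" "cmod t \<le> 1" "t \<noteq> 0"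
    have R: "(\<lambda>n. 16 * M * (cmod (s - e n) + cmod (t - e n))) \<longlonglongrightarrow> 16 * M * (cmod (s - 0) + cmod (t - 0))"
      by (intro tendsto_intros e0)
    have L: "(\<lambda>n. norm (\<Delta> h v s t - \<Delta> h v (e n) (e n))) \<longlonglongrightarrow> norm (\<Delta> h v s t - B)"
      by (intro tendsto_intros B)
    have "norm (\<Delta> h v s t - B) \<le> 16 * M * (cmod (s - 0) + cmod (t - 0))"
      by (rule LIMSEQ_le[OF L R]) (use \<Delta>_lipschitz[OF hv st(1,2) e st(3,4) e] in blast)
    then show "norm (\<Delta> h v s t - B) \<le> 16 * M * (cmod s + cmod t)" by simp
  qed
qed

definition quot :: "'a \<Rightarrow> 'a \<Rightarrow> complex \<Rightarrow> 'b"
  where "quot h v t =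
    (1 / t) *\<^sub>C (blinfun_apply (FD F (x + t *\<^sub>C h)) v - blinfun_apply (FD F x) v)"

text \<open>Letting the increment in v go to 0 first, with t fixed, replaces differences of F by
  values of DF; bounds on \<open>\<Delta>\<close> thus become bounds on difference quotients of
  DF.\<close>

lemma \<Delta>_tendsto_quot:
  assumes "norm h \<le> r" "norm v \<le> r" "cmod t \<le> 1"
  shows "((\<lambda>s. \<Delta> h v t s) \<longlongrightarrow> quot h v t) (at 0)"
proof -
  have x: "x \<in> ball x (5 * r)" "x + t *\<^sub>C h \<in> ball x (5 * r)"
    using in_ball[of h v 0 0] in_ball[of h v t 0] assms by auto
  have "((\<lambda>s. (1 / t) *\<^sub>C ((1 / s) *\<^sub>C (F (x + t *\<^sub>C h + s *\<^sub>C v) - F (x + t *\<^sub>C h))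
      - (1 / s) *\<^sub>C (F (x + s *\<^sub>C v) - F x))) \<longlongrightarrow> quot h v t) (at 0)"
    unfolding quot_def by (intro tendsto_intros tendsto_scaleC_at_0[OF cdiff] x)
  moreover have "(1 / t) *\<^sub>C ((1 / s) *\<^sub>C (F (x + t *\<^sub>C h + s *\<^sub>C v) - F (x + t *\<^sub>C h))
      - (1 / s) *\<^sub>C (F (x + s *\<^sub>C v) - F x)) = \<Delta> h v t s" for s
    by (simp add: \<Delta>_def scaleC_diff_right scaleC_add_right)
  ultimately show ?thesis by simp
qed

text \<open>One limit B serves both orders because \<open>\<Delta>\<close> is symmetric under
  exchanging the two directions; this is where symmetry of the second derivative comes from.\<close>

lemma quot_limit_small:
  assumes hv: "norm h \<le> r" "norm v \<le> r"
  obtains B where "norm B \<le> 16 * M"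
    "\<And>t. cmod t \<le> 1 \<Longrightarrow> t \<noteq> 0 \<Longrightarrow> norm (quot h v t - B) \<le> 16 * M * cmod t"
    "\<And>t. cmod t \<le> 1 \<Longrightarrow> t \<noteq> 0 \<Longrightarrow> norm (quot v h t - B) \<le> 16 * M * cmod t"
proof -
  obtain B where B: "norm B \<le> 16 * M"
    "\<And>s t. cmod s \<le> 1 \<Longrightarrow> s \<noteq> 0 \<Longrightarrow> cmod t \<le> 1 \<Longrightarrow> t \<noteq> 0 \<Longrightarrow>
      norm (\<Delta> h v s t - B) \<le> 16 * M * (cmod s + cmod t)"
    using \<Delta>_limit_small[OF hv] by blast
  have ev: "\<forall>\<^sub>F s in at 0. cmod s \<le> 1 \<and> s \<noteq> 0"
    unfolding eventually_at by (rule exI[of _ 1]) (auto simp: dist_norm)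
  have lim: "((\<lambda>s. 16 * M * (cmod t + cmod s)) \<longlongrightarrow> 16 * M * (cmod t + cmod 0)) (at 0)" for t
    by (intro tendsto_intros)
  have 1: "norm (quot h v t - B) \<le> 16 * M * cmod t" if t: "cmod t \<le> 1" "t \<noteq> 0" for t
  proof -
    have "norm (quot h v t - B) \<le> 16 * M * (cmod t + cmod 0)"
      by (rule tendsto_le[OF _ lim, OF _ tendsto_norm[OF tendsto_diff[OF \<Delta>_tendsto_quot[OF hv t(1)] tendsto_const]]])
         (use B(2)[OF t] in \<open>auto intro: eventually_mono[OF ev]\<close>)
    then show ?thesis by simp
  qed
  have 2: "norm (quot v h t - B) \<le> 16 * M * cmod t" if t: "cmod t \<le> 1" "t \<noteq> 0" for t
  proof -
    have "norm (quot v h t - B) \<le> 16 * M * (cmod t + cmod 0)"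
      by (rule tendsto_le[OF _ lim, OF _ tendsto_norm[OF tendsto_diff[OF \<Delta>_tendsto_quot[OF hv(2,1) t(1)] tendsto_const]]])
         (use B(2)[OF _ _ t] in \<open>auto simp: \<Delta>_commute[of v h] add.commute intro!: eventually_mono[OF ev]\<close>)
    then show ?thesis by simp
  qed
  show thesis using that B(1) 1 2 by blast
qed

definition D2 :: "'a \<Rightarrow> 'a \<Rightarrow> 'b"
  where "D2 h v = Lim (at 0) (quot h v)"

lemma D2_eqI: "(quot h v \<longlongrightarrow> B) (at 0) \<Longrightarrow> D2 h v = B"
  unfolding D2_def by (intro tendsto_Lim) auto

lemma D2_small:
  assumes hv: "norm h \<le> r" "norm v \<le> r"
  shows "norm (D2 h v) \<le> 16 * M"
    and "cmod t \<le> 1 \<Longrightarrow> t \<noteq> 0 \<Longrightarrow> norm (quot h v t - D2 h v) \<le> 16 * M * cmod t"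
    and "(quot h v \<longlongrightarrow> D2 h v) (at 0)"
    and "D2 h v = D2 v h"
proof -
  obtain B where B: "norm B \<le> 16 * M"
    "\<And>t. cmod t \<le> 1 \<Longrightarrow> t \<noteq> 0 \<Longrightarrow> norm (quot h v t - B) \<le> 16 * M * cmod t"
    "\<And>t. cmod t \<le> 1 \<Longrightarrow> t \<noteq> 0 \<Longrightarrow> norm (quot v h t - B) \<le> 16 * M * cmod t"
    using quot_limit_small[OF hv] by blast
  have *: "(f \<longlongrightarrow> B) (at 0)"
    if "\<And>t. cmod t \<le> 1 \<Longrightarrow> t \<noteq> 0 \<Longrightarrow> norm (f t - B) \<le> 16 * M * cmod t" for f :: "complex \<Rightarrow> 'b"
  proof (rule Lim_null[THEN iffD2], rule Lim_null_comparison)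
    show "\<forall>\<^sub>F t in at 0. norm (f t - B) \<le> 16 * M * cmod t"
      unfolding eventually_at by (rule exI[of _ 1]) (auto intro: that)
    show "((\<lambda>t. 16 * M * cmod t) \<longlongrightarrow> 0) (at 0)"
      by (auto intro!: tendsto_eq_intros)
  qed
  have lim: "(quot h v \<longlongrightarrow> B) (at 0)" "(quot v h \<longlongrightarrow> B) (at 0)"
    using *[OF B(2)] *[OF B(3)] by auto
  then have "D2 h v = B" "D2 v h = B" by (auto intro: D2_eqI)
  with B lim show "norm (D2 h v) \<le> 16 * M" "D2 h v = D2 v h" "(quot h v \<longlongrightarrow> D2 h v) (at 0)"
    "cmod t \<le> 1 \<Longrightarrow> t \<noteq> 0 \<Longrightarrow> norm (quot h v t - D2 h v) \<le> 16 * M * cmod t"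
    by auto
qed

lemma eventually_in_ball: "\<forall>\<^sub>F t in at 0. x + t *\<^sub>C h \<in> ball x (5 * r)"
proof -
  have "((\<lambda>t. x + t *\<^sub>C h) \<longlongrightarrow> x + 0 *\<^sub>C h) (at 0)"
    by (intro tendsto_intros)
  then have "((\<lambda>t. x + t *\<^sub>C h) \<longlongrightarrow> x) (at 0)" by simp
  from topological_tendstoD[OF this open_ball, of x "5 * r"] show ?thesis
    using r_pos by simp
qed

lemma tendsto_scaled:
  assumes lim: "(quot h v \<longlongrightarrow> B) (at 0)"
  shows "(quot (c *\<^sub>C h) v \<longlongrightarrow> c *\<^sub>C B) (at 0)"
proof (cases "c = 0")
  case True
  have "quot 0 v = (\<lambda>_. 0)" by (auto simp: quot_def)
  with True show ?thesis by simp
next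
  case False
  have "filterlim (\<lambda>t. c * t) (at 0) (at 0)"
    unfolding filterlim_at using False
    by (auto intro!: tendsto_eq_intros simp: eventually_at_filter)
  from tendsto_scaleC[OF tendsto_const filterlim_compose[OF lim this], of c]
  have "((\<lambda>t. c *\<^sub>C quot h v (c * t)) \<longlongrightarrow> c *\<^sub>C B) (at 0)" .
  moreover have "c *\<^sub>C quot h v (c * t) = quot (c *\<^sub>C h) v t" for t
    using False by (simp add: quot_def mult.commute)
  ultimately show ?thesis by simp
qed

lemma quot_scale: "x + t *\<^sub>C h \<in> ball x (5 * r) \<Longrightarrow> quot h (c *\<^sub>C v) t = c *\<^sub>C quot h v t"
  using r_pos by (simp add: quot_def cdiff_on_FD(2)[OF cdiff] scaleC_diff_right mult.commute)

lemma quot_add: "quot h (v + w) t = quot h v t + quot h w t"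
  by (simp add: quot_def blinfun.add_right scaleC_diff_right scaleC_add_right)

text \<open>The quotients are controlled for directions of norm at most r. The remaining directions
  are reached by homogeneity: a factor of h is absorbed into the increment t, and a factor of v
  comes out by complex linearity of DF as soon as t is so small that x + t h lies in the ball. The
  scale c is large enough for both vectors.\<close>

lemma quot_tendsto_D2: "(quot h v \<longlongrightarrow> D2 h v) (at 0)"
proof -
  define c where "c = 1 + (norm h + norm v) / r"
  have c: "1 \<le> c" using r_pos by (simp add: c_def)
  have le: "norm w \<le> c * r" if "w = h \<or> w = v" for w
    using that r_pos by (auto simp: c_def field_simps)
  define h' v' where "h' = complex_of_real (1 / c) *\<^sub>C h" and "v' = complex_of_real (1 / c) *\<^sub>C v"
  have "norm h' \<le> r" "norm v' \<le> r"
    using le c by (auto simp: h'_def v'_def norm_divide field_simps)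
  note lim = D2_small(3)[OF this]
  have hv: "h = complex_of_real c *\<^sub>C h'" "v = complex_of_real c *\<^sub>C v'"
    using c by (simp_all add: h'_def v'_def)
  have "((\<lambda>t. complex_of_real c *\<^sub>C quot h v' t) \<longlongrightarrow> complex_of_real c *\<^sub>C complex_of_real c *\<^sub>C D2 h' v') (at 0)"
    unfolding hv(1) by (intro tendsto_scaleC tendsto_const tendsto_scaled lim)
  moreover have "\<forall>\<^sub>F t in at 0. complex_of_real c *\<^sub>C quot h v' t = quot h v t"
    using eventually_in_ball[of h] by eventually_elim (simp only: quot_scale hv(2))
  ultimately have "(quot h v \<longlongrightarrow> complex_of_real c *\<^sub>C complex_of_real c *\<^sub>C D2 h' v') (at 0)"
    by (rule Lim_transform_eventually)
  then show ?thesis using D2_eqI by metis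
qed

lemma D2_scale_left: "D2 (c *\<^sub>C h) v = c *\<^sub>C D2 h v"
  by (intro D2_eqI tendsto_scaled quot_tendsto_D2)

lemma D2_scale_right: "D2 h (c *\<^sub>C v) = c *\<^sub>C D2 h v"
proof (rule D2_eqI, rule Lim_transform_eventually)
  show "((\<lambda>t. c *\<^sub>C quot h v t) \<longlongrightarrow> c *\<^sub>C D2 h v) (at 0)"
    by (intro tendsto_intros quot_tendsto_D2)
  show "\<forall>\<^sub>F t in at 0. c *\<^sub>C quot h v t = quot h (c *\<^sub>C v) t"
    using eventually_in_ball[of h] by eventually_elim (simp only: quot_scale)
qed

lemma D2_add_right: "D2 h (v + w) = D2 h v + D2 h w"
  unfolding D2_eqI[of h "v + w", OF tendsto_add[OF quot_tendsto_D2[of h v] quot_tendsto_D2[of h w],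
      folded quot_add]] ..

text \<open>Reduces statements about all directions to directions of norm at most r. The zero vector
  is no exception, because r / 0 = 0 makes the rescaled vector vanish and its factor is 0 as
  well.\<close>

lemma D2_rescale:
  obtains h' v' c d where "norm h' \<le> r" "norm v' \<le> r"
    "h = complex_of_real c *\<^sub>C h'" "v = complex_of_real d *\<^sub>C v'" "c = norm h / r" "d = norm v / r"
proof (rule that[of "complex_of_real (r / norm h) *\<^sub>C h" "complex_of_real (r / norm v) *\<^sub>C v"])
qed (use r_pos in \<open>auto simp: norm_divide norm_mult\<close>)

lemma D2_commute: "D2 h v = D2 v h"
proof -
  obtain h' v' c d where "norm h' \<le> r" "norm v' \<le> r"
    "h = complex_of_real c *\<^sub>C h'" "v = complex_of_real d *\<^sub>C v'"
    using D2_rescale by metis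
  then show ?thesis
    using D2_small(4)[of h' v'] by (simp add: D2_scale_left D2_scale_right mult.commute)
qed

lemma D2_add_left: "D2 (h + k) v = D2 h v + D2 k v"
  by (simp add: D2_commute[of _ v] D2_add_right)

lemma D2_bound: "norm (D2 h v) \<le> norm h * norm v * (16 * M / r\<^sup>2)"
proof -
  obtain h' v' c d where *: "norm h' \<le> r" "norm v' \<le> r"
    "h = complex_of_real c *\<^sub>C h'" "v = complex_of_real d *\<^sub>C v'" "c = norm h / r" "d = norm v / r"
    using D2_rescale by metis
  have c: "0 \<le> c" "0 \<le> d" using *(5,6) r_pos by simp_all
  have "norm (D2 h v) = c * d * norm (D2 h' v')"
    unfolding *(3,4) D2_scale_left D2_scale_right norm_scaleC using c by simp
  also have "\<dots> \<le> c * d * (16 * M)"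
    using D2_small(1)[OF *(1,2)] *(5,6) r_pos by (intro mult_left_mono) auto
  finally show ?thesis using *(5,6) by (simp add: power2_eq_square)
qed

lemma bounded_bilinear_D2: "bounded_bilinear D2"
proof
  show "\<exists>K. \<forall>h v. norm (D2 h v) \<le> norm h * norm v * K"
    using D2_bound by blast
qed (simp_all add: D2_add_left D2_add_right scaleR_scaleC D2_scale_left D2_scale_right)

text \<open>The difference quotients converge at a rate uniform in the direction v, so limits taken
  direction by direction give differentiability in operator norm. After rescaling the increment is c
  = norm h / r; the factor c from the increment, c from the rate and d from v make up norm h squared
  times norm v over r cubed.\<close>

lemma FD_remainder:
  assumes h: "norm h \<le> r"
  shows "norm (FD F (x + h) - FD F x - Blinfun (D2 h)) \<le> 16 * M / r ^ 3 * (norm h)\<^sup>2"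
proof (cases "h = 0")
  case True
  have "D2 0 = (\<lambda>_. 0)" using D2_scale_left[of 0 0] by auto
  with True show ?thesis by (simp add: zero_blinfun.abs_eq)
next
  case False
  show ?thesis
  proof (rule norm_blinfun_bound)
    fix v :: 'a
    obtain h' v' c d where *: "norm h' \<le> r" "norm v' \<le> r"
      "h = complex_of_real c *\<^sub>C h'" "v = complex_of_real d *\<^sub>C v'" "c = norm h / r" "d = norm v / r"
      using D2_rescale by metis
    have c: "0 < c" "c \<le> 1" using False h r_pos by (simp_all add: *(5))
    have d: "0 \<le> d" using r_pos by (simp add: *(6))
    have xh: "x + complex_of_real c *\<^sub>C h' \<in> ball x (5 * r)"
      using in_ball[of h' v' c 0] *(1,2) c by simp
    have "blinfun_apply (FD F (x + h) - FD F x - Blinfun (D2 h)) v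
        = complex_of_real d *\<^sub>C complex_of_real c *\<^sub>C (quot h' v' c - D2 h' v')"
    proof -
      have "blinfun_apply (Blinfun (D2 h)) v = D2 h v"
        by (simp add: bounded_linear_Blinfun_apply bounded_bilinear.bounded_linear_right[OF bounded_bilinear_D2])
      also have "\<dots> = complex_of_real d *\<^sub>C complex_of_real c *\<^sub>C D2 h' v'"
        unfolding *(3,4) D2_scale_left D2_scale_right by (simp add: mult.commute)
      finally show ?thesis
        unfolding *(3,4) using c xh r_pos
        by (simp add: blinfun.diff_left quot_def scaleC_diff_right cdiff_on_FD(2)[OF cdiff])
    qed
    also have "norm \<dots> = d * (c * norm (quot h' v' c - D2 h' v'))"
      using c d by (simp add: norm_mult)
    also have "\<dots> \<le> d * (c * (16 * M * cmod c))"
      using D2_small(2)[OF *(1,2), of c] c d by (intro mult_left_mono) auto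
    also have "cmod c = c" using c by simp
    also have "d * (c * (16 * M * c)) = 16 * M / r ^ 3 * (norm h)\<^sup>2 * norm v"
      by (simp add: *(5,6) power2_eq_square power3_eq_cube ac_simps)
    finally show "norm (blinfun_apply (FD F (x + h) - FD F x - Blinfun (D2 h)) v)
        \<le> 16 * M / r ^ 3 * (norm h)\<^sup>2 * norm v" .
  qed (use M_nonneg r_pos in auto)
qed

lemma FD_complex_derivative:
  "\<exists>D. bounded_complex_linear D \<and> (FD F has_derivative D) (at x)"
proof (intro exI conjI)
  have ap: "blinfun_apply (Blinfun (D2 h)) = D2 h" for h
    by (simp add: bounded_linear_Blinfun_apply bounded_bilinear.bounded_linear_right[OF bounded_bilinear_D2])
  have bl: "bounded_linear (\<lambda>h. Blinfun (D2 h))"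
  proof (rule bounded_linear_intro)
    show "norm (Blinfun (D2 h)) \<le> norm h * (16 * M / r\<^sup>2)" for h
    proof (rule norm_blinfun_bound)
      show "norm (blinfun_apply (Blinfun (D2 h)) v) \<le> norm h * (16 * M / r\<^sup>2) * norm v" for v
        using D2_bound[of h v] by (simp only: ap mult.assoc mult.commute[of "norm v"])
    qed (use M_nonneg r_pos in simp)
  qed (auto intro!: blinfun_eqI simp: ap D2_add_left blinfun.add_left blinfun.scaleR_left
        scaleR_scaleC D2_scale_left)
  then show "bounded_complex_linear (\<lambda>h. Blinfun (D2 h))"
    by (auto simp: bounded_complex_linear_def complex_linear_def ap D2_add_left D2_scale_left
        blinfun.add_left intro!: blinfun_eqI)
  show "(FD F has_derivative (\<lambda>h. Blinfun (D2 h))) (at x)"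
    unfolding has_derivative_at
  proof (intro conjI bl)
    show "(\<lambda>h. norm (FD F (x + h) - FD F x - Blinfun (D2 h)) / norm h) \<midarrow>0\<rightarrow> 0"
    proof (rule Lim_null_comparison)
      show "((\<lambda>h. 16 * M / r ^ 3 * norm h) \<longlongrightarrow> 0) (at 0)"
        using r_pos by (auto intro!: tendsto_eq_intros)
      have "norm (norm (FD F (x + h) - FD F x - Blinfun (D2 h)) / norm h) \<le> 16 * M / r ^ 3 * norm h"
        if "norm h < r" "h \<noteq> 0" for h
        using FD_remainder[of h] that by (simp add: divide_le_eq power2_eq_square mult.assoc)
      then show "\<forall>\<^sub>F h in at 0. norm (norm (FD F (x + h) - FD F x - Blinfun (D2 h)) / norm h)
          \<le> 16 * M / r ^ 3 * norm h"
        unfolding eventually_at using r_pos by (intro exI[of _ r]) (auto simp: dist_norm)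
    qed
  qed
qed

end

text \<open>Continuity at x supplies a ball on which F is bounded by norm (F x) + 1, and this bound
  feeds the Cauchy estimates. Since the conclusion has the form of the hypothesis, iteration reaches
  derivatives of every order.\<close>

lemma cdiff_on_FD_cdiff_on:
  fixes F :: "'a::complex_banach \<Rightarrow> 'b::complex_banach"
  assumes F: "cdiff_on F S" and S: "open S"
  shows "cdiff_on (FD F) S"
  unfolding cdiff_on_def
proof
  fix x assume "x \<in> S"
  have "isCont F x"
    using cdiff_on_imp_continuous_on[OF F] S \<open>x \<in> S\<close> by (simp add: continuous_on_eq_continuous_at)
  then have "\<forall>\<^sub>F y in nhds x. dist (F y) (F x) < 1"
    by (simp add: isCont_def tendstoD tendsto_at_iff_tendsto_nhds[symmetric])
  moreover have "\<forall>\<^sub>F y in nhds x. y \<in> S"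
    using S \<open>x \<in> S\<close> by (rule eventually_nhds_in_open)
  ultimately have "\<forall>\<^sub>F y in nhds x. y \<in> S \<and> norm (F y) \<le> norm (F x) + 1"
  proof eventually_elim
    case (elim y)
    then show ?case using norm_triangle_sub[of "F y" "F x"] by (simp add: dist_norm)
  qed
  then obtain d where d: "0 < d" "\<And>y. y \<in> ball x d \<Longrightarrow> y \<in> S \<and> norm (F y) \<le> norm (F x) + 1"
    unfolding eventually_nhds_metric by (auto simp: dist_commute)
  have "ball_bounded_cdiff F x (d / 5) (norm (F x) + 1)"
    using d by unfold_locales (auto intro: cdiff_on_subset[OF F])
  then show "\<exists>D. bounded_complex_linear D \<and> (FD F has_derivative D) (at x)"
    by (rule ball_bounded_cdiff.FD_complex_derivative)
qed

section \<open>Taylor expansion and inversion along rays\<close>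

text \<open>Integral form of the remainder, with the kernel estimated crudely by t^(p-1); it is the
  order in t that matters later.\<close>

lemma taylor_bound:
  fixes Df :: "nat \<Rightarrow> real \<Rightarrow> 'b::banach"
  assumes Df: "\<And>m t. m < p \<Longrightarrow> 0 \<le> t \<Longrightarrow> t \<le> d \<Longrightarrow>
      (Df m has_vector_derivative Df (Suc m) t) (at t within {0..d})"
    and K: "\<And>t. 0 \<le> t \<Longrightarrow> t \<le> d \<Longrightarrow> norm (Df p t) \<le> K"
    and p: "0 < p" and t: "0 \<le> t" "t \<le> d"
  shows "norm (Df 0 t - (\<Sum>i<p. (t ^ i / fact i) *\<^sub>R Df i 0)) \<le> K * t ^ p"
proof -
  define i where "i x = ((t - x) ^ (p - 1) / fact (p - 1)) *\<^sub>R Df p x" for x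
  have "(i has_integral Df 0 t - (\<Sum>i<p. ((t - 0) ^ i / fact i) *\<^sub>R Df i 0)) {0..t}"
    unfolding i_def
  proof (rule Taylor_has_integral[OF p refl])
    show "(Df m has_vector_derivative Df (Suc m) s) (at s within {0..t})"
      if "m < p" "0 \<le> s" "s \<le> t" for m s
      using Df[of m s] that t by (auto elim: has_vector_derivative_within_subset)
  qed (use t in auto)
  then have *: "(i has_integral Df 0 t - (\<Sum>i<p. (t ^ i / fact i) *\<^sub>R Df i 0)) (cbox 0 t)"
    by simp
  have "0 \<le> K" using order_trans[OF norm_ge_zero K[of 0]] t by simp
  have "norm (i x) \<le> K * t ^ (p - 1)" if "x \<in> cbox 0 t" for x
  proof -
    have x: "0 \<le> x" "x \<le> t" using that by auto
    have "norm (i x) = (t - x) ^ (p - 1) / fact (p - 1) * norm (Df p x)"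
      using x by (simp add: i_def)
    also have "\<dots> \<le> t ^ (p - 1) * K"
    proof (intro mult_mono K)
      have "(t - x) ^ (p - 1) / fact (p - 1) \<le> (t - x) ^ (p - 1) / 1"
        using x by (intro divide_left_mono) (auto simp: fact_ge_1)
      also have "\<dots> \<le> t ^ (p - 1)" using x by (auto intro: power_mono)
      finally show "(t - x) ^ (p - 1) / fact (p - 1) \<le> t ^ (p - 1)" .
    qed (use x t in auto)
    finally show ?thesis by (simp add: mult.commute)
  qed
  moreover have "0 \<le> K * t ^ (p - 1)" using t \<open>0 \<le> K\<close> by simp
  ultimately have "norm (Df 0 t - (\<Sum>i<p. (t ^ i / fact i) *\<^sub>R Df i 0))
      \<le> K * t ^ (p - 1) * measure lborel (cbox 0 t)"
    using has_integral_bound[OF _ *] by blast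
  moreover have "measure lborel (cbox 0 t) = t" using t by simp
  ultimately have "norm (Df 0 t - (\<Sum>i<p. (t ^ i / fact i) *\<^sub>R Df i 0)) \<le> K * t ^ (p - 1) * t"
    by (simp only:)
  moreover have "t ^ p = t ^ (p - 1) * t" using p by (cases p) simp_all
  ultimately show ?thesis by (simp add: mult.assoc)
qed

lemma FD_line_has_vector_derivative:
  fixes F :: "'a::complex_banach \<Rightarrow> 'b::complex_banach"
  assumes "cdiff_on F S" "t *\<^sub>R v \<in> S"
  shows "((\<lambda>t. F (t *\<^sub>R v)) has_vector_derivative blinfun_apply (FD F (t *\<^sub>R v)) v) (at t within U)"
proof -
  have "((\<lambda>t. t *\<^sub>R v) has_derivative (\<lambda>s. s *\<^sub>R v)) (at t within U)"
    by (intro bounded_linear_imp_has_derivative bounded_linear_scaleR_left)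
  from has_derivative_compose[OF this has_derivative_at_withinI[OF cdiff_on_FD(1)[OF assms], of UNIV, simplified]]
  show ?thesis by (simp add: has_vector_derivative_def blinfun.scaleR_right)
qed

lemma has_vector_derivative_blinfun_apply:
  "(A has_vector_derivative A') F \<Longrightarrow> ((\<lambda>t. blinfun_apply (A t) v) has_vector_derivative blinfun_apply A' v) F"
  by (rule bounded_linear.has_vector_derivative[OF blinfun.bounded_linear_left])

text \<open>The expansion runs along the real segment from 0 in direction v, where \<open>f0\<close>
  to \<open>f5\<close> are the successive derivatives of t -> F(t v). The last is continuous on a
  compact interval, which provides K. The second estimate is Taylor's formula for the same list
  shifted by one place.\<close>

lemma cdiff_on_taylor:
  fixes F :: "'a::complex_banach \<Rightarrow> 'a"
  assumes F: "cdiff_on F (ball 0 1)"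
  obtains K d where "0 < d"
    "\<forall>t\<in>{0..d}.
      norm (F (t *\<^sub>R v) - (F 0 + t *\<^sub>R blinfun_apply (FD F 0) v + (t\<^sup>2 / 2) *\<^sub>R D2_diag F v
        + (t ^ 3 / 6) *\<^sub>R D3_diag F v + (t ^ 4 / 24) *\<^sub>R D4_diag F v)) \<le> K * t ^ 5"
    "\<forall>t\<in>{0..d}.
      norm (blinfun_apply (FD F (t *\<^sub>R v)) v - (blinfun_apply (FD F 0) v + t *\<^sub>R D2_diag F v
        + (t\<^sup>2 / 2) *\<^sub>R D3_diag F v + (t ^ 3 / 6) *\<^sub>R D4_diag F v)) \<le> K * t ^ 4"
proof -
  note C1 = cdiff_on_FD_cdiff_on[OF F open_ball]
  note C2 = cdiff_on_FD_cdiff_on[OF C1 open_ball]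
  note C3 = cdiff_on_FD_cdiff_on[OF C2 open_ball]
  note C4 = cdiff_on_FD_cdiff_on[OF C3 open_ball]
  note C5 = cdiff_on_FD_cdiff_on[OF C4 open_ball]
  define f0 where "f0 t = F (t *\<^sub>R v)" for t
  define f1 where "f1 t = blinfun_apply (FD F (t *\<^sub>R v)) v" for t
  define f2 where "f2 t = blinfun_apply (blinfun_apply (FD (FD F) (t *\<^sub>R v)) v) v" for t
  define f3 where "f3 t = blinfun_apply (blinfun_apply (blinfun_apply (FD (FD (FD F)) (t *\<^sub>R v)) v) v) v" for t
  define f4 where "f4 t = blinfun_apply (blinfun_apply (blinfun_apply (blinfun_apply
    (FD (FD (FD (FD F))) (t *\<^sub>R v)) v) v) v) v" for t
  define f5 where "f5 t = blinfun_apply (blinfun_apply (blinfun_apply (blinfun_apply (blinfun_apply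
    (FD (FD (FD (FD (FD F)))) (t *\<^sub>R v)) v) v) v) v) v" for t
  \<comment> \<open>The added 1 keeps the closed segment strictly inside the unit ball and covers v
    = 0.\<close>
  define d where "d = 1 / (norm v + 1)"
  have "0 < d" by (simp add: d_def add_nonneg_pos)
  have ball: "t *\<^sub>R v \<in> ball 0 1" if "0 \<le> t" "t \<le> d" for t
  proof -
    have "norm (t *\<^sub>R v) \<le> d * norm v" using that by (auto intro: mult_right_mono)
    also have "\<dots> < 1" by (simp add: d_def divide_less_eq add_nonneg_pos)
    finally show ?thesis by simp
  qed
  have d0: "(f0 has_vector_derivative f1 t) (at t within {0..d})" if "0 \<le> t" "t \<le> d" for t
    using FD_line_has_vector_derivative[OF F ball[OF that]] unfolding f0_def f1_def by auto
  have d1: "(f1 has_vector_derivative f2 t) (at t within {0..d})" if "0 \<le> t" "t \<le> d" for t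
    unfolding f1_def f2_def using ball[OF that]
    by (intro has_vector_derivative_blinfun_apply FD_line_has_vector_derivative[OF C1])
  have d2: "(f2 has_vector_derivative f3 t) (at t within {0..d})" if "0 \<le> t" "t \<le> d" for t
    unfolding f2_def f3_def using ball[OF that]
    by (intro has_vector_derivative_blinfun_apply FD_line_has_vector_derivative[OF C2])
  have d3: "(f3 has_vector_derivative f4 t) (at t within {0..d})" if "0 \<le> t" "t \<le> d" for t
    unfolding f3_def f4_def using ball[OF that]
    by (intro has_vector_derivative_blinfun_apply FD_line_has_vector_derivative[OF C3])
  have d4: "(f4 has_vector_derivative f5 t) (at t within {0..d})" if "0 \<le> t" "t \<le> d" for t
    unfolding f4_def f5_def using ball[OF that]
    by (intro has_vector_derivative_blinfun_apply FD_line_has_vector_derivative[OF C4])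
  have "continuous_on {0..d} f5"
    unfolding f5_def using ball
    by (intro continuous_intros continuous_on_compose2[OF cdiff_on_imp_continuous_on[OF C5]]) auto
  then have "bounded (f5 ` {0..d})"
    by (intro compact_imp_bounded compact_continuous_image compact_Icc)
  then obtain K where "\<forall>y\<in>f5 ` {0..d}. norm y \<le> K"
    unfolding bounded_iff by blast
  then have K: "norm (f5 t) \<le> K" if "0 \<le> t" "t \<le> d" for t
    using that by simp
  define Df where "Df = (\<lambda>m. [f0, f1, f2, f3, f4, f5] ! m)"
  have Df: "(Df m has_vector_derivative Df (Suc m) t) (at t within {0..d})"
    if "m < 5" "0 \<le> t" "t \<le> d" for m t
  proof -
    have "m \<in> {0, 1, 2, 3, 4}" using that by auto
    then show ?thesis using d0 d1 d2 d3 d4 that(2,3)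
      by (auto simp: Df_def numeral_eq_Suc)
  qed
  have K': "norm (Df 5 t) \<le> K" if "0 \<le> t" "t \<le> d" for t
    using K that by (simp add: Df_def numeral_eq_Suc)
  show thesis
  proof (rule that[OF \<open>0 < d\<close> ballI ballI])
    fix t assume "t \<in> {0..d}"
    then have t: "0 \<le> t" "t \<le> d" by auto
    from taylor_bound[of 5 d Df K t, OF Df K' _ t]
    show "norm (F (t *\<^sub>R v) - (F 0 + t *\<^sub>R blinfun_apply (FD F 0) v + (t\<^sup>2 / 2) *\<^sub>R D2_diag F v
        + (t ^ 3 / 6) *\<^sub>R D3_diag F v + (t ^ 4 / 24) *\<^sub>R D4_diag F v)) \<le> K * t ^ 5"
      by (simp add: Df_def eval_nat_numeral lessThan_Suc f0_def f1_def f2_def f3_def f4_def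
          D2_diag_def D3_diag_def D4_diag_def fact_numeral ac_simps)
  next
    fix t assume "t \<in> {0..d}"
    then have t: "0 \<le> t" "t \<le> d" by auto
    have "norm (Df (Suc 0) t - (\<Sum>i<4. (t ^ i / fact i) *\<^sub>R Df (Suc i) 0)) \<le> K * t ^ 4"
      by (rule taylor_bound[of 4 d "\<lambda>i. Df (Suc i)" K t, OF _ _ _ t])
         (use Df K' in \<open>auto simp: numeral_eq_Suc\<close>)
    then show "norm (blinfun_apply (FD F (t *\<^sub>R v)) v - (blinfun_apply (FD F 0) v + t *\<^sub>R D2_diag F v
        + (t\<^sup>2 / 2) *\<^sub>R D3_diag F v + (t ^ 3 / 6) *\<^sub>R D4_diag F v)) \<le> K * t ^ 4"
      by (simp add: Df_def eval_nat_numeral lessThan_Suc f0_def f1_def f2_def f3_def f4_def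
          D2_diag_def D3_diag_def D4_diag_def fact_numeral ac_simps)
  qed
qed

text \<open>A bounded inverse at z0 amounts to a lower bound norm u / k for the operator; a
  perturbation of norm below 1/(2 k) destroys at most half of it.\<close>

lemma eventually_bounded_below_blinfun:
  fixes A :: "'c::t2_space \<Rightarrow> 'a::real_normed_vector \<Rightarrow>\<^sub>L 'b::real_normed_vector"
  assumes A: "isCont A z0" and inj: "inj (blinfun_apply (A z0))"
    and bl: "bounded_linear (inv (blinfun_apply (A z0)))"
  obtains C where "0 < C" "\<forall>\<^sub>F z in at z0. \<forall>u. norm u \<le> C * norm (blinfun_apply (A z) u)"
proof -
  obtain k where k: "0 < k" "\<And>y. norm (inv (blinfun_apply (A z0)) y) \<le> norm y * k"
    using bounded_linear.pos_bounded[OF bl] by blast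
  have *: "norm u \<le> norm (blinfun_apply (A z0) u) * k" for u
    using k(2)[of "blinfun_apply (A z0) u"] by (simp add: inv_f_f[OF inj])
  have "\<forall>\<^sub>F z in at z0. dist (A z) (A z0) < 1 / (2 * k)"
    using A k(1) by (intro tendstoD) (auto simp: isCont_def)
  then have "\<forall>\<^sub>F z in at z0. \<forall>u. norm u \<le> 2 * k * norm (blinfun_apply (A z) u)"
  proof eventually_elim
    case (elim z)
    show ?case
    proof
      fix u
      have "norm (blinfun_apply (A z0 - A z) u) \<le> norm (A z0 - A z) * norm u"
        by (rule norm_blinfun)
      also have "\<dots> \<le> 1 / (2 * k) * norm u"
        using elim by (intro mult_right_mono) (auto simp: dist_norm norm_minus_commute)
      finally have "norm (blinfun_apply (A z0) u) \<le> norm (blinfun_apply (A z) u) + 1 / (2 * k) * norm u"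
        using norm_triangle_sub[of "blinfun_apply (A z0) u" "blinfun_apply (A z) u"]
        by (simp add: blinfun.diff_left)
      then have "norm u \<le> (norm (blinfun_apply (A z) u) + 1 / (2 * k) * norm u) * k"
        using *[of u] k(1) by (meson mult_right_mono less_imp_le order_trans)
      then show "norm u \<le> 2 * k * norm (blinfun_apply (A z) u)"
        using k(1) by (simp add: field_simps)
    qed
  qed
  then show thesis using k(1) that[of "2 * k"] by simp
qed

text \<open>Differentiates A(s) w(s) = b(s) without differentiating the inversion of operators.
  Applying A(s) to the error of the difference quotient of w gives \<open>R s\<close>, which tends
  to 0 because L solves A(0) L = b' - A' w(0); the uniform lower bound for A(s) carries this back to
  the error.\<close>

lemma solution_of_linear_system_tendsto:
  fixes A :: "complex \<Rightarrow> 'a::complex_banach \<Rightarrow>\<^sub>L 'b::complex_banach"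
  assumes cont: "isCont A 0"
    and A: "((\<lambda>s. (1 / s) *\<^sub>C (A s - A 0)) \<longlongrightarrow> A') (at 0)"
    and b: "((\<lambda>s. (1 / s) *\<^sub>C (b s - b 0)) \<longlongrightarrow> b') (at 0)"
    and bij: "bij (blinfun_apply (A 0))"
    and bl: "bounded_linear (inv (blinfun_apply (A 0)))"
    and lin: "\<forall>\<^sub>F s in at 0. \<forall>c u. blinfun_apply (A s) (c *\<^sub>C u) = c *\<^sub>C blinfun_apply (A s) u"
    and eq: "\<forall>\<^sub>F s in at 0. blinfun_apply (A s) (w s) = b s"
    and eq0: "blinfun_apply (A 0) (w 0) = b 0"
  shows "((\<lambda>s. (1 / s) *\<^sub>C (w s - w 0)) \<longlongrightarrow>
    inv (blinfun_apply (A 0)) (b' - blinfun_apply A' (w 0))) (at 0)"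
proof -
  define L where "L = inv (blinfun_apply (A 0)) (b' - blinfun_apply A' (w 0))"
  have L: "blinfun_apply (A 0) L = b' - blinfun_apply A' (w 0)"
    unfolding L_def using bij by (simp add: bij_is_surj surj_f_inv_f)
  define R where "R s = (1 / s) *\<^sub>C (b s - b 0)
    - blinfun_apply ((1 / s) *\<^sub>C (A s - A 0)) (w 0) - blinfun_apply (A s) L" for s
  obtain C where C: "0 < C" "\<forall>\<^sub>F s in at 0. \<forall>u. norm u \<le> C * norm (blinfun_apply (A s) u)"
    using eventually_bounded_below_blinfun[OF cont bij_is_inj[OF bij] bl] by blast
  have "(R \<longlongrightarrow> b' - blinfun_apply A' (w 0) - blinfun_apply (A 0) L) (at 0)"
    unfolding R_def using cont by (intro tendsto_intros A b) (simp add: isCont_def)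
  then have R: "(R \<longlongrightarrow> 0) (at 0)" by (simp add: L)
  have "((\<lambda>s. (1 / s) *\<^sub>C (w s - w 0) - L) \<longlongrightarrow> 0) (at 0)"
  proof (rule Lim_null_comparison)
    show "((\<lambda>s. C * norm (R s)) \<longlongrightarrow> 0) (at 0)"
      using tendsto_mult_right_zero[OF tendsto_norm_zero[OF R]] .
    show "\<forall>\<^sub>F s in at 0. norm ((1 / s) *\<^sub>C (w s - w 0) - L) \<le> C * norm (R s)"
      using C(2) lin eq
    proof eventually_elim
      case (elim s)
      have "blinfun_apply (A s) ((1 / s) *\<^sub>C (w s - w 0) - L) = R s"
        using elim(2,3) eq0 by (simp add: R_def blinfun.diff_right blinfun.diff_left scaleC_diff_right)
      with elim(1) show ?case by metis
    qed
  qed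
  then show ?thesis unfolding L_def by (simp add: LIM_zero_iff)
qed

text \<open>The vector DF(z x0)^-1 F(z x0) solves a linear system whose operator and right-hand side
  are complex differentiable in z, the operator because DF is holomorphic. The bounded functional T
  turns the vector derivative of the solution into a complex derivative.\<close>

lemma inverse_derivative_holomorphic:
  fixes F :: "'a::complex_banach \<Rightarrow> 'a"
  assumes F: "locally_biholomorphic F" and x0: "norm x0 \<le> 1" and T: "bounded_complex_linear T"
  shows "(\<lambda>z. T (inv (blinfun_apply (FD F (z *\<^sub>C x0))) (F (z *\<^sub>C x0)))) holomorphic_on ball 0 1"
    (is "?h holomorphic_on _")
proof -
  have C0: "cdiff_on F (ball 0 1)"
    using F by (simp add: locally_biholomorphic_def holomorphic_ball_def cdiff_on_def)
  note C1 = cdiff_on_FD_cdiff_on[OF C0 open_ball]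
  have ball: "z *\<^sub>C x0 \<in> ball 0 1" if "cmod z < 1" for z
  proof -
    have "cmod z * norm x0 \<le> cmod z * 1" using x0 by (intro mult_left_mono) auto
    with that show ?thesis by simp
  qed
  have bij: "bij (blinfun_apply (FD F x))" "bounded_linear (inv (blinfun_apply (FD F x)))"
    if "x \<in> ball 0 1" for x
    using F that by (auto simp: locally_biholomorphic_def)
  show ?thesis
  proof (rule holomorphic_onI)
    fix z :: complex assume "z \<in> ball 0 1"
    then have z: "cmod z < 1" by simp
    define w where "w s = inv (blinfun_apply (FD F (z *\<^sub>C x0 + s *\<^sub>C x0))) (F (z *\<^sub>C x0 + s *\<^sub>C x0))" for s
    have ev: "\<forall>\<^sub>F s in at 0. z *\<^sub>C x0 + s *\<^sub>C x0 \<in> ball 0 1"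
    proof -
      have "((\<lambda>s. z *\<^sub>C x0 + s *\<^sub>C x0) \<longlongrightarrow> z *\<^sub>C x0 + 0 *\<^sub>C x0) (at 0)"
        by (intro tendsto_intros)
      then have "((\<lambda>s. z *\<^sub>C x0 + s *\<^sub>C x0) \<longlongrightarrow> z *\<^sub>C x0) (at 0)" by simp
      from topological_tendstoD[OF this open_ball ball[OF z]] show ?thesis .
    qed
    have "isCont (FD F) (z *\<^sub>C x0 + 0 *\<^sub>C x0)"
      using cdiff_on_imp_continuous_on[OF C1] ball[OF z] by (simp add: continuous_on_eq_continuous_at)
    then have cont: "isCont (\<lambda>s. FD F (z *\<^sub>C x0 + s *\<^sub>C x0)) 0"
      by (rule continuous_at_compose[unfolded o_def, rotated])
         (intro continuous_intros bounded_linear.continuous[OF bounded_linear_scaleC_left])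
    obtain D where D: "((\<lambda>s. (1 / s) *\<^sub>C (w s - w 0)) \<longlongrightarrow> D) (at 0)"
    proof (rule that, rule solution_of_linear_system_tendsto[where A = "\<lambda>s. FD F (z *\<^sub>C x0 + s *\<^sub>C x0)"
            and b = "\<lambda>s. F (z *\<^sub>C x0 + s *\<^sub>C x0)"])
      show "\<forall>\<^sub>F s in at 0. \<forall>c u. blinfun_apply (FD F (z *\<^sub>C x0 + s *\<^sub>C x0)) (c *\<^sub>C u) =
          c *\<^sub>C blinfun_apply (FD F (z *\<^sub>C x0 + s *\<^sub>C x0)) u"
        using ev by eventually_elim (simp add: cdiff_on_FD(2)[OF C0])
      show "\<forall>\<^sub>F s in at 0. blinfun_apply (FD F (z *\<^sub>C x0 + s *\<^sub>C x0)) (w s) = F (z *\<^sub>C x0 + s *\<^sub>C x0)"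
        using ev by eventually_elim (simp add: w_def bij bij_is_surj surj_f_inv_f)
      show "((\<lambda>s. (1 / s) *\<^sub>C (F (z *\<^sub>C x0 + s *\<^sub>C x0) - F (z *\<^sub>C x0 + 0 *\<^sub>C x0)))
          \<longlongrightarrow> blinfun_apply (FD F (z *\<^sub>C x0)) x0) (at 0)"
        using tendsto_scaleC_at_0[OF C0 ball[OF z]] by simp
      show "((\<lambda>s. (1 / s) *\<^sub>C (FD F (z *\<^sub>C x0 + s *\<^sub>C x0) - FD F (z *\<^sub>C x0 + 0 *\<^sub>C x0)))
          \<longlongrightarrow> blinfun_apply (FD (FD F) (z *\<^sub>C x0)) x0) (at 0)"
        using tendsto_scaleC_at_0[OF C1 ball[OF z]] by simp
    qed (use cont bij[OF ball[OF z]] in \<open>simp_all add: w_def bij_is_surj surj_f_inv_f\<close>)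
    from bounded_linear.tendsto[OF bounded_complex_linearD(1)[OF T] this]
    have "((\<lambda>s. (?h (z + s) - ?h z) / s) \<longlongrightarrow> T D) (at 0)"
      by (simp add: w_def bounded_complex_linearD[OF T] scaleC_add_left)
    then have "(?h has_field_derivative T D) (at z)"
      by (simp add: DERIV_def)
    then show "?h field_differentiable at z within ball 0 1"
      using field_differentiable_def field_differentiable_at_within by blast
  qed
qed

section \<open>The coefficient bound\<close>

text \<open>Expansions are known only for real t decreasing to 0; continuity of g at 0 makes this
  one-sided information enough to identify g(0).\<close>

lemma holomorphic_first_coeff:
  fixes g :: "complex \<Rightarrow> complex" and c :: "real \<Rightarrow> complex"
  assumes g: "g holomorphic_on ball 0 1"
    and lim: "((\<lambda>t. (g (of_real t) - c t) / of_real t ^ n) \<longlongrightarrow> 0) (at_right 0)"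
    and c: "(c \<longlongrightarrow> l) (at_right 0)"
  shows "g 0 = l"
proof -
  have "isCont g 0"
    using holomorphic_on_imp_continuous_on[OF g] by (simp add: continuous_on_eq_continuous_at)
  moreover have "((\<lambda>t. complex_of_real t) \<longlongrightarrow> 0) (at_right 0)"
    by (auto intro!: tendsto_eq_intros)
  ultimately have "((\<lambda>t. g (of_real t)) \<longlongrightarrow> g 0) (at_right 0)"
    by (rule isCont_tendsto_compose)
  then have "((\<lambda>t. g (of_real t) - c t) \<longlongrightarrow> g 0 - l) (at_right 0)"
    by (intro tendsto_diff c)
  moreover have "((\<lambda>t. g (of_real t) - c t) \<longlongrightarrow> 0) (at_right 0)"
  proof (rule Lim_transform_eventually)
    have "((\<lambda>t. complex_of_real t ^ n) \<longlongrightarrow> 0 ^ n) (at_right 0)"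
      by (auto intro!: tendsto_eq_intros)
    from tendsto_mult[OF lim this]
    show "((\<lambda>t. (g (of_real t) - c t) / of_real t ^ n * of_real t ^ n) \<longlongrightarrow> 0) (at_right 0)"
      by simp
    show "\<forall>\<^sub>F t in at_right 0. (g (of_real t) - c t) / of_real t ^ n * of_real t ^ n = g (of_real t) - c t"
      by (auto simp: eventually_at_filter)
  qed
  ultimately have "g 0 - l = 0"
    by (rule tendsto_unique[rotated]) simp
  then show ?thesis by simp
qed

text \<open>For \<alpha> > 0 the region is the disc with diameter from 0 to 1/\<alpha>, for \<alpha>
  = 0 the right half-plane; the Mobius map sends it into the unit disc and 1 to 0. Comparing
  numerator and denominator without forming the quotient also shows that the denominator does not
  vanish.\<close>

lemma starlike_region_mobius:
  fixes w :: complex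
  assumes "\<alpha> < 1" "\<alpha> * (cmod w)\<^sup>2 < Re w"
  shows "cmod (1 - w) < cmod (1 + (1 - 2 * of_real \<alpha>) * w)"
proof -
  have "(cmod (1 + (1 - 2 * of_real \<alpha>) * w))\<^sup>2 - (cmod (1 - w))\<^sup>2
      = 4 * (1 - \<alpha>) * (Re w - \<alpha> * (cmod w)\<^sup>2)"
    unfolding cmod_power2 by (simp add: power2_eq_square algebra_simps)
  also have "\<dots> > 0" using assms by simp
  finally show ?thesis using power2_less_imp_less by fastforce
qed

lemma starlike_region_midpoint:
  fixes u v :: complex
  assumes "0 \<le> \<alpha>" "\<alpha> * (cmod u)\<^sup>2 < Re u" "\<alpha> * (cmod v)\<^sup>2 < Re v"
  shows "\<alpha> * (cmod ((u + v) / 2))\<^sup>2 < Re ((u + v) / 2)"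
proof -
  have "(cmod ((u + v) / 2))\<^sup>2 \<le> ((cmod u)\<^sup>2 + (cmod v)\<^sup>2) / 2"
    using zero_le_power2[of "Re u - Re v"] zero_le_power2[of "Im u - Im v"]
    unfolding cmod_power2 by (simp add: power2_eq_square field_simps)
  then have "\<alpha> * (cmod ((u + v) / 2))\<^sup>2 \<le> \<alpha> * (((cmod u)\<^sup>2 + (cmod v)\<^sup>2) / 2)"
    using assms(1) by (intro mult_left_mono)
  with assms show ?thesis by (simp add: algebra_simps)
qed

text \<open>An even function has zero derivative at 0, so f(z)/z again vanishes at 0 and the Schwarz
  lemma applies a second time. That requires a strict bound for f(z)/z: equality at some point would
  make f a rotation, whose derivative at 0 is not zero.\<close>

lemma even_schwarz:
  assumes f: "f holomorphic_on ball 0 1" and f0: "f 0 = 0"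
    and lt: "\<And>z. cmod z < 1 \<Longrightarrow> cmod (f z) < 1"
    and even: "\<And>z. f (- z) = f z"
    and z: "cmod z < 1"
  shows "cmod (f z) \<le> (cmod z)\<^sup>2"
proof -
  have "(f has_field_derivative deriv f 0) (at (- 0))"
    using holomorphic_derivI[OF f open_ball, of 0 UNIV] by simp
  from DERIV_chain2[OF this DERIV_minus[OF DERIV_ident]]
  have "(f has_field_derivative - deriv f 0) (at 0)"
    by (simp add: even)
  then have "deriv f 0 = - deriv f 0" by (rule DERIV_imp_deriv)
  then have df: "deriv f 0 = 0" by (simp add: eq_neg_iff_add_eq_0)
  define g where "g w = (if w = 0 then 0 else f w / w)" for w
  have g: "g holomorphic_on ball 0 1"
    by (rule pole_theorem_open_0[OF f open_ball, of 0]) (auto simp: g_def df f0)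
  have g1: "cmod (g w) < 1" if w: "cmod w < 1" for w
  proof (cases "w = 0")
    case False
    have "cmod (f w) \<noteq> cmod w"
    proof
      assume "cmod (f w) = cmod w"
      then obtain c where c: "\<And>z. cmod z < 1 \<Longrightarrow> f z = c * z" "cmod c = 1"
        using Schwarz_Lemma(3)[OF f f0 lt w] w False by blast
      have "(f has_field_derivative c) (at 0)"
      proof (rule has_field_derivative_transform_within_open)
        show "((\<lambda>z. c * z) has_field_derivative c) (at 0)"
          by (auto intro!: derivative_eq_intros)
      qed (use c in \<open>auto intro: open_ball[of 0 1]\<close>)
      then have "deriv f 0 = c" by (rule DERIV_imp_deriv)
      with df c show False by simp
    qed
    with Schwarz_Lemma(1)[OF f f0 lt w] have "cmod (f w) < cmod w" by simp
    with False show ?thesis by (simp add: g_def norm_divide divide_less_eq)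
  qed (simp add: g_def)
  have "cmod (g z) \<le> cmod z"
    by (rule Schwarz_Lemma(1)[OF g _ g1 z]) (auto simp: g_def)
  then show ?thesis
    by (cases "z = 0") (auto simp: g_def f0 norm_divide divide_le_eq power2_eq_square)
qed

text \<open>Averaging over z and -z kills the odd coefficients and keeps the values in the
  convex region, so the even Schwarz lemma bounds the coefficient of z^3 directly.\<close>

lemma starlike_third_coeff_bound:
  fixes h :: "complex \<Rightarrow> complex" and \<alpha> :: real
  assumes \<alpha>: "0 \<le> \<alpha>" "\<alpha> < 1"
    and h: "h holomorphic_on ball 0 1"
    and region: "\<And>z. cmod z < 1 \<Longrightarrow> z \<noteq> 0 \<Longrightarrow> \<alpha> * (cmod (h z / z))\<^sup>2 < Re (h z / z)"
    and lim: "((\<lambda>t. (h (of_real t) - (of_real t + a * of_real t ^ 2 + b * of_real t ^ 3))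
        / of_real t ^ 3) \<longlongrightarrow> 0) (at_right 0)"
  shows "cmod b \<le> 2 * (1 - \<alpha>)"
proof -
  have T: "((\<lambda>t. complex_of_real t) \<longlongrightarrow> 0) (at_right 0)"
    by (auto intro!: tendsto_eq_intros)
  \<comment> \<open>One factor z is split off at a time: h = z p, p = 1 + z q, q = a + z r. At each
    stage the limit on the real axis, now divided by one power of t less, identifies the value at 0,
    ending with r(0) = b.\<close>
  have split: "\<exists>g. g holomorphic_on ball 0 1 \<and> (\<forall>z. cmod z < 1 \<longrightarrow> f z = f 0 + z * g z)"
    if "f holomorphic_on ball 0 1" for f :: "complex \<Rightarrow> complex"
  proof -
    have "(\<lambda>z. f z - f 0) holomorphic_on ball 0 1"
      by (intro holomorphic_intros that)
    then obtain g where "g holomorphic_on ball 0 1" "\<And>z. cmod z < 1 \<Longrightarrow> f z - f 0 = z * g z"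
      by (rule Schwarz3) auto
    then show ?thesis by (metis add.commute diff_add_cancel)
  qed
  have small: "\<forall>\<^sub>F t in at_right 0. cmod (complex_of_real t) < 1 \<and> t \<noteq> 0"
    unfolding eventually_at by (rule exI[of _ 1]) (auto simp: dist_norm)
  have "h 0 = 0"
    by (rule holomorphic_first_coeff[OF h lim]) (auto intro!: tendsto_eq_intros T)
  then obtain p where p: "p holomorphic_on ball 0 1" "\<And>z. cmod z < 1 \<Longrightarrow> h z = z * p z"
    using split[OF h] by auto
  have limp: "((\<lambda>t. (p (of_real t) - (1 + a * of_real t + b * of_real t ^ 2)) / of_real t ^ 2) \<longlongrightarrow> 0) (at_right 0)"
  proof (rule Lim_transform_eventually[OF lim])
    show "\<forall>\<^sub>F t in at_right 0. (h (of_real t) - (of_real t + a * of_real t ^ 2 + b * of_real t ^ 3)) / of_real t ^ 3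
        = (p (of_real t) - (1 + a * of_real t + b * of_real t ^ 2)) / of_real t ^ 2"
      using small by eventually_elim (simp add: p(2) power2_eq_square power3_eq_cube field_simps)
  qed
  have p0: "p 0 = 1"
    by (rule holomorphic_first_coeff[OF p(1) limp]) (auto intro!: tendsto_eq_intros T)
  then obtain q where q: "q holomorphic_on ball 0 1" "\<And>z. cmod z < 1 \<Longrightarrow> p z = 1 + z * q z"
    using split[OF p(1)] by auto
  have limq: "((\<lambda>t. (q (of_real t) - (a + b * of_real t)) / of_real t ^ 1) \<longlongrightarrow> 0) (at_right 0)"
  proof (rule Lim_transform_eventually[OF limp])
    show "\<forall>\<^sub>F t in at_right 0. (p (of_real t) - (1 + a * of_real t + b * of_real t ^ 2)) / of_real t ^ 2
        = (q (of_real t) - (a + b * of_real t)) / of_real t ^ 1"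
      using small by eventually_elim (simp add: q(2) power2_eq_square field_simps)
  qed
  have q0: "q 0 = a"
    by (rule holomorphic_first_coeff[OF q(1) limq]) (auto intro!: tendsto_eq_intros T)
  then obtain r where r: "r holomorphic_on ball 0 1" "\<And>z. cmod z < 1 \<Longrightarrow> q z = a + z * r z"
    using split[OF q(1)] by auto
  have limr: "((\<lambda>t. (r (of_real t) - b) / of_real t ^ 0) \<longlongrightarrow> 0) (at_right 0)"
  proof (rule Lim_transform_eventually[OF limq])
    show "\<forall>\<^sub>F t in at_right 0. (q (of_real t) - (a + b * of_real t)) / of_real t ^ 1
        = (r (of_real t) - b) / of_real t ^ 0"
      using small by eventually_elim (simp add: r(2) field_simps)
  qed
  have r0: "r 0 = b"
    by (rule holomorphic_first_coeff[OF r(1) limr]) (auto intro!: tendsto_eq_intros)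
  have rp: "\<alpha> * (cmod (p z))\<^sup>2 < Re (p z)" if "cmod z < 1" for z
    using region[OF that] p(2)[OF that] p0 \<alpha> by (cases "z = 0") auto
  define Q where "Q z = (p z + p (- z)) / 2" for z
  define \<beta> where "\<beta> = 1 - 2 * complex_of_real \<alpha>"
  define \<omega> where "\<omega> z = (1 - Q z) / (1 + \<beta> * Q z)" for z
  have neg: "(\<lambda>z. f (- z)) holomorphic_on ball 0 1" if "f holomorphic_on ball 0 1"
    for f :: "complex \<Rightarrow> complex"
    by (rule holomorphic_on_compose_gen[unfolded o_def, OF _ that]) (auto intro!: holomorphic_intros)
  have Qh: "Q holomorphic_on ball 0 1"
    unfolding Q_def by (intro holomorphic_intros p(1) neg) auto
  have Q: "cmod (1 - Q z) < cmod (1 + \<beta> * Q z)" if "cmod z < 1" for z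
    unfolding \<beta>_def Q_def
    by (intro starlike_region_mobius starlike_region_midpoint rp \<alpha>) (use that in auto)
  then have Qn: "1 + \<beta> * Q z \<noteq> 0" if "cmod z < 1" for z
    using that norm_ge_zero[of "1 - Q z"] by (metis norm_zero not_less)
  have \<omega>: "cmod (\<omega> z) \<le> (cmod z)\<^sup>2" if "cmod z < 1" for z
  proof (rule even_schwarz[OF _ _ _ _ that])
    show "\<omega> holomorphic_on ball 0 1"
      unfolding \<omega>_def using Qn by (intro holomorphic_intros Qh) auto
    show "\<omega> 0 = 0" by (simp add: \<omega>_def Q_def p0)
    show "cmod (\<omega> z) < 1" if "cmod z < 1" for z
      using Q[OF that] Qn[OF that] by (simp add: \<omega>_def norm_divide divide_less_eq)
    show "\<omega> (- z) = \<omega> z" for z by (simp add: \<omega>_def Q_def add.commute)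
  qed
  \<comment> \<open>Here 1 - Q(z) equals -z^2 (r(z) + r(-z)) / 2. Cancelling z^2 in the even Schwarz
    bound and letting z tend to 0 leaves |b| on the left and, as Q(0) = 1, the value 1 + (1 -
    2\<alpha>) = 2 (1 - \<alpha>) on the right.\<close>
  have le: "cmod ((r z + r (- z)) / 2) \<le> cmod (1 + \<beta> * Q z)" if z: "cmod z < 1" "z \<noteq> 0" for z
  proof -
    have "1 - Q z = - (z\<^sup>2 * ((r z + r (- z)) / 2))"
      using z(1) by (simp add: Q_def q r power2_eq_square field_simps)
    then have "cmod (1 - Q z) = (cmod z)\<^sup>2 * cmod ((r z + r (- z)) / 2)"
      by (simp only: norm_minus_cancel norm_mult norm_power)
    moreover have "cmod (1 - Q z) \<le> (cmod z)\<^sup>2 * cmod (1 + \<beta> * Q z)"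
      using \<omega>[OF z(1)] Qn[OF z(1)] by (simp add: \<omega>_def norm_divide divide_le_eq)
    ultimately have "(cmod z)\<^sup>2 * cmod ((r z + r (- z)) / 2) \<le> (cmod z)\<^sup>2 * cmod (1 + \<beta> * Q z)"
      by (simp only:)
    then show ?thesis by (rule mult_left_le_imp_le) (use z(2) in simp)
  qed
  have tend: "(f \<longlongrightarrow> f 0) (at 0)" if "f holomorphic_on ball 0 1" for f :: "complex \<Rightarrow> complex"
    using holomorphic_on_imp_continuous_on[OF that]
    by (simp add: continuous_on_eq_continuous_at isCont_def)
  have "cmod ((r 0 + r (- 0)) / 2) \<le> cmod (1 + \<beta> * Q 0)"
  proof (rule tendsto_le)
    show "((\<lambda>z. cmod ((r z + r (- z)) / 2)) \<longlongrightarrow> cmod ((r 0 + r (- 0)) / 2)) (at 0)"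
      by (intro tendsto_intros tend[OF r(1)] tend[OF neg[OF r(1)]]) auto
    show "((\<lambda>z. cmod (1 + \<beta> * Q z)) \<longlongrightarrow> cmod (1 + \<beta> * Q 0)) (at 0)"
      by (intro tendsto_intros tend[OF Qh])
    show "\<forall>\<^sub>F z in at 0. cmod ((r z + r (- z)) / 2) \<le> cmod (1 + \<beta> * Q z)"
      unfolding eventually_at by (rule exI[of _ 1]) (use le in \<open>auto simp: dist_norm\<close>)
  qed auto
  moreover have "1 + \<beta> * Q 0 = complex_of_real (2 * (1 - \<alpha>))"
    by (simp add: Q_def p0 \<beta>_def)
  ultimately show ?thesis using \<alpha> by (simp add: r0 del: of_real_mult of_real_diff)
qed

text \<open>The constants 2 and 6 are the factorials, so these are comparisons with f(t) v and f'(t)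
  v for f(t) = t + b t^2 + c t^3. The term with \<open>D4_diag\<close> is counted as part of the
  error.\<close>

lemma radial_taylor:
  fixes F :: "'a::complex_banach \<Rightarrow> 'a"
  assumes F: "cdiff_on F (ball 0 1)" "F 0 = 0" "blinfun_apply (FD F 0) v = v"
    and D2: "D2_diag F v = (2 * b) *\<^sub>C v" and D3: "D3_diag F v = (6 * c) *\<^sub>C v"
  shows "((\<lambda>t. (1 / complex_of_real t ^ 3) *\<^sub>C (F (t *\<^sub>R v)
      - (of_real t + b * of_real t ^ 2 + c * of_real t ^ 3) *\<^sub>C v)) \<longlongrightarrow> 0) (at_right 0)"
    and "((\<lambda>t. (1 / complex_of_real t ^ 2) *\<^sub>C (blinfun_apply (FD F (t *\<^sub>R v)) v
      - (1 + 2 * b * of_real t + 3 * c * of_real t ^ 2) *\<^sub>C v)) \<longlongrightarrow> 0) (at_right 0)"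
proof -
  obtain K d where d: "0 < d"
    and 1: "\<forall>t\<in>{0..d}.
      norm (F (t *\<^sub>R v) - (F 0 + t *\<^sub>R blinfun_apply (FD F 0) v + (t\<^sup>2 / 2) *\<^sub>R D2_diag F v
        + (t ^ 3 / 6) *\<^sub>R D3_diag F v + (t ^ 4 / 24) *\<^sub>R D4_diag F v)) \<le> K * t ^ 5"
    and 2: "\<forall>t\<in>{0..d}.
      norm (blinfun_apply (FD F (t *\<^sub>R v)) v - (blinfun_apply (FD F 0) v + t *\<^sub>R D2_diag F v
        + (t\<^sup>2 / 2) *\<^sub>R D3_diag F v + (t ^ 3 / 6) *\<^sub>R D4_diag F v)) \<le> K * t ^ 4"
    by (rule cdiff_on_taylor[OF F(1), of v], rule that; assumption)
  have small: "\<forall>\<^sub>F t in at_right 0. 0 < t \<and> t \<le> d"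
    unfolding eventually_at using d by (intro exI[of _ d]) (auto simp: dist_norm)
  \<comment> \<open>The error is the Taylor remainder of order t^(n+2) plus the single discarded
    term y of order t^(n+1), with n = 3 for F and n = 2 for its derivative.\<close>
  have div: "norm ((1 / complex_of_real t ^ n) *\<^sub>C x) \<le> K * t ^ 2 + k * t"
    if "0 < t" "norm (x - y) \<le> K * t ^ (n + 2)" "norm y \<le> k * t ^ Suc n" for n t k and x y :: 'a
  proof -
    have "norm x \<le> K * t ^ (n + 2) + k * t ^ Suc n"
      using norm_triangle_sub[of x y] that(2,3) by linarith
    also have "\<dots> = t ^ n * (K * t ^ 2 + k * t)"
      by (simp add: power_add algebra_simps power2_eq_square)
    finally show ?thesis
      using that(1) by (simp add: norm_divide norm_power divide_le_eq mult.commute)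
  qed
  have lim: "((\<lambda>t. K * t ^ 2 + k * t) \<longlongrightarrow> 0) (at_right 0)" for k
    by (auto intro!: tendsto_eq_intros)
  show "((\<lambda>t. (1 / complex_of_real t ^ 3) *\<^sub>C (F (t *\<^sub>R v)
      - (of_real t + b * of_real t ^ 2 + c * of_real t ^ 3) *\<^sub>C v)) \<longlongrightarrow> 0) (at_right 0)"
  proof (rule Lim_null_comparison[OF _ lim[of "norm (D4_diag F v)"]])
    show "\<forall>\<^sub>F t in at_right 0. norm ((1 / complex_of_real t ^ 3) *\<^sub>C (F (t *\<^sub>R v)
      - (of_real t + b * of_real t ^ 2 + c * of_real t ^ 3) *\<^sub>C v)) \<le> K * t ^ 2 + norm (D4_diag F v) * t"
      using small
    proof eventually_elim
      case (elim t)
      show ?case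
      proof (rule div)
        show "norm (F (t *\<^sub>R v) - (of_real t + b * of_real t ^ 2 + c * of_real t ^ 3) *\<^sub>C v
            - (t ^ 4 / 24) *\<^sub>R D4_diag F v) \<le> K * t ^ (3 + 2)"
          using bspec[OF 1, of t] elim by (simp add: F D2 D3 scaleR_scaleC scaleC_add_left algebra_simps)
        show "norm ((t ^ 4 / 24) *\<^sub>R D4_diag F v) \<le> norm (D4_diag F v) * t ^ Suc 3"
          by (simp add: field_simps)
      qed (use elim in simp)
    qed
  qed
  show "((\<lambda>t. (1 / complex_of_real t ^ 2) *\<^sub>C (blinfun_apply (FD F (t *\<^sub>R v)) v
      - (1 + 2 * b * of_real t + 3 * c * of_real t ^ 2) *\<^sub>C v)) \<longlongrightarrow> 0) (at_right 0)"
  proof (rule Lim_null_comparison[OF _ lim[of "norm (D4_diag F v)"]])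
    show "\<forall>\<^sub>F t in at_right 0. norm ((1 / complex_of_real t ^ 2) *\<^sub>C (blinfun_apply (FD F (t *\<^sub>R v)) v
      - (1 + 2 * b * of_real t + 3 * c * of_real t ^ 2) *\<^sub>C v)) \<le> K * t ^ 2 + norm (D4_diag F v) * t"
      using small
    proof eventually_elim
      case (elim t)
      show ?case
      proof (rule div)
        show "norm (blinfun_apply (FD F (t *\<^sub>R v)) v - (1 + 2 * b * of_real t + 3 * c * of_real t ^ 2) *\<^sub>C v
            - (t ^ 3 / 6) *\<^sub>R D4_diag F v) \<le> K * t ^ (2 + 2)"
          using bspec[OF 2, of t] elim by (simp add: F D2 D3 scaleR_scaleC scaleC_add_left algebra_simps)
        show "norm ((t ^ 3 / 6) *\<^sub>R D4_diag F v) \<le> norm (D4_diag F v) * t ^ Suc 2"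
          using elim by (simp add: field_simps)
      qed (use elim in simp)
    qed
  qed
qed

text \<open>Squaring the disc inequality, cancelling the square of 1/(2\<alpha>) and multiplying by
  \<alpha> leaves a condition that also makes sense at \<alpha> = 0, where it is the half-plane
  condition. This removes the case distinction from both the bound and the extremal example.\<close>

lemma starlike_mappings_region:
  fixes F :: "'a::complex_banach \<Rightarrow> 'a"
  assumes \<alpha>: "0 \<le> \<alpha>" "\<alpha> < 1" and F: "normalized F" "locally_biholomorphic F"
  shows "F \<in> starlike_mappings \<alpha> \<longleftrightarrow>
    (\<forall>x\<in>ball 0 1 - {0}. \<forall>T\<in>support_functionals x.
      let w = T (inv (blinfun_apply (FD F x)) (F x)) / complex_of_real (norm x)
      in \<alpha> * (cmod w)\<^sup>2 < Re w)"
proof -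
  have *: "(if \<alpha> = 0 then Re w > 0
        else cmod (1 / complex_of_real (norm x) * w - 1 / (2 * complex_of_real \<alpha>)) < 1 / (2 * \<alpha>))
      \<longleftrightarrow> \<alpha> * (cmod (w / complex_of_real (norm x)))\<^sup>2 < Re (w / complex_of_real (norm x))"
    if "x \<noteq> 0" for w and x :: 'a
  proof (cases "\<alpha> = 0")
    case True
    then show ?thesis using that by (simp add: zero_less_divide_iff)
  next
    case False
    define u where "u = w / complex_of_real (norm x)"
    have "cmod (u - 1 / (2 * complex_of_real \<alpha>)) < 1 / (2 * \<alpha>)
        \<longleftrightarrow> (cmod (u - 1 / (2 * complex_of_real \<alpha>)))\<^sup>2 < (1 / (2 * \<alpha>))\<^sup>2"
      using False \<alpha> by (simp add: power_mono_iff flip: not_le)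
    also have "1 / (2 * complex_of_real \<alpha>) = complex_of_real (1 / (2 * \<alpha>))" by simp
    also have "(cmod (u - complex_of_real (1 / (2 * \<alpha>))))\<^sup>2
        = (cmod u)\<^sup>2 - Re u / \<alpha> + (1 / (2 * \<alpha>))\<^sup>2"
      using False unfolding cmod_power2 by (simp add: power2_eq_square field_simps)
    also have "\<dots> < (1 / (2 * \<alpha>))\<^sup>2 \<longleftrightarrow> \<alpha> * (cmod u)\<^sup>2 < Re u"
      using False \<alpha> by (simp add: field_simps)
    finally show ?thesis using False by (simp add: u_def)
  qed
  show ?thesis
    unfolding starlike_mappings_def using F * by (auto simp: Let_def)
qed

lemma starlike_coefficient_bound:
  fixes F :: "'a::complex_banach \<Rightarrow> 'a"
  assumes \<alpha>: "0 \<le> \<alpha>" "\<alpha> < 1" and S: "F \<in> starlike_mappings \<alpha>"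
    and H: "radial_terms F H" and x0: "norm x0 = 1" and T: "T \<in> support_functionals x0"
  shows "cmod (A3 F x0 T - (A2 F x0 T)\<^sup>2) \<le> 1 - \<alpha>"
proof -
  have F: "normalized F" "locally_biholomorphic F"
    using S by (auto simp: starlike_mappings_def)
  have C: "cdiff_on F (ball 0 1)"
    using F by (simp add: locally_biholomorphic_def holomorphic_ball_def cdiff_on_def)
  have Tl: "bounded_complex_linear T" and Tx: "T x0 = 1" and Tn: "onorm T = 1"
    using T x0 by (auto simp: support_functionals_def)
  note Tlin = bounded_complex_linearD[OF Tl]
  define b c where "b = H 1 x0" and "c = H 2 x0"
  have D2: "D2_diag F x0 = (2 * b) *\<^sub>C x0"
  proof -
    have "D2_diag F x0 = 2 *\<^sub>R (D2_diag F x0 /\<^sub>R fact 2)" by simp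
    also have "\<dots> = 2 *\<^sub>R (b *\<^sub>C x0)" using H by (simp only: radial_terms_def b_def)
    finally show ?thesis by (simp add: scaleR_scaleC)
  qed
  have D3: "D3_diag F x0 = (6 * c) *\<^sub>C x0"
  proof -
    have "D3_diag F x0 = 6 *\<^sub>R (D3_diag F x0 /\<^sub>R fact 3)" by (simp add: fact_numeral)
    also have "\<dots> = 6 *\<^sub>R (c *\<^sub>C x0)" using H by (simp only: radial_terms_def c_def)
    finally show ?thesis by (simp add: scaleR_scaleC)
  qed
  have A: "A3 F x0 T - (A2 F x0 T)\<^sup>2 = c - b\<^sup>2"
    by (simp add: A3_def A2_def D2 D3 Tlin Tx fact_numeral)
  define G where "G x = inv (blinfun_apply (FD F x)) (F x)" for x
  define h where "h z = T (G (z *\<^sub>C x0))" for z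
  have hh: "h holomorphic_on ball 0 1"
    unfolding h_def G_def using F(2) x0 Tl by (intro inverse_derivative_holomorphic) auto
  have region: "\<alpha> * (cmod (h z / z))\<^sup>2 < Re (h z / z)" if z: "cmod z < 1" "z \<noteq> 0" for z
  proof -
    define u where "u = cnj z / complex_of_real (cmod z)"
    have "cnj z * z = complex_of_real (cmod z) * cmod z"
      using complex_norm_square[of z] by (simp add: power2_eq_square mult.commute)
    then have u: "cmod u = 1" "u * z = cmod z"
      using z by (simp_all add: u_def norm_divide)
    have "(\<lambda>x. u * T x) \<in> support_functionals (z *\<^sub>C x0)"
    proof -
      have bl: "bounded_linear (\<lambda>x. u * T x)"
        by (intro bounded_linear_const_mult Tlin)
      have le: "cmod (T x) \<le> norm x" for x
        using onorm[OF Tlin(1), of x] Tn by simp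
      have "onorm (\<lambda>x. u * T x) = 1"
      proof (rule antisym)
        show "onorm (\<lambda>x. u * T x) \<le> 1" by (rule onorm_bound) (auto simp: norm_mult u le)
        show "1 \<le> onorm (\<lambda>x. u * T x)"
          using onorm[OF bl, of x0] by (simp add: norm_mult u Tx x0)
      qed
      then show ?thesis
        using bl u(2) by (simp add: support_functionals_def bounded_complex_linear_def complex_linear_def
            Tlin Tx x0 algebra_simps)
    qed
    moreover have "z *\<^sub>C x0 \<in> ball 0 1 - {0}"
    proof -
      have "norm (z *\<^sub>C x0) = cmod z" by (simp add: x0)
      with z show ?thesis by (metis DiffI mem_ball_0 norm_eq_zero singletonD)
    qed
    ultimately have "\<alpha> * (cmod (u * h z / cmod (z)))\<^sup>2 < Re (u * h z / cmod z)"
      using S starlike_mappings_region[OF \<alpha> F] x0 by (fastforce simp: Let_def h_def G_def)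
    moreover have "u * h z / cmod z = h z / z"
      using u(2) z by (simp add: field_simps)
    ultimately show ?thesis by simp
  qed
  \<comment> \<open>Coefficients of t^2 and t^3 in f/f' for f(t) = t + b t^2 + c t^3;
    \<open>pt\<close> is this quotient truncated after t^3.\<close>
  define a' b' where "a' = - b" and "b' = 2 * b\<^sup>2 - 2 * c"
  define pt where "pt t = complex_of_real t + a' * of_real t ^ 2 + b' * of_real t ^ 3" for t
  have "FD F 0 = id_blinfun" and F0: "F 0 = 0"
    using F(1) by (auto simp: normalized_def)
  then have FD0: "blinfun_apply (FD F 0) x0 = x0" by simp
  note taylor = radial_taylor[OF C F0 FD0 D2 D3]
  have bij: "bij (blinfun_apply (FD F x))" "bounded_linear (inv (blinfun_apply (FD F x)))"
    if "x \<in> ball 0 1" for x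
    using F that by (auto simp: locally_biholomorphic_def)
  \<comment> \<open>The inverse operator is not expanded. DF(t x0), applied to the difference of G(t
    x0) and \<open>pt t\<close> times x0, gives t^3 R(t) with R(t) tending to 0, and the lower bound
    of DF near 0 transfers the smallness to the difference itself.\<close>
  have lim: "((\<lambda>t. (1 / complex_of_real t ^ 3) *\<^sub>C (G (t *\<^sub>R x0) - pt t *\<^sub>C x0)) \<longlongrightarrow> 0) (at_right 0)"
  proof -
    have "isCont (FD F) 0"
      using cdiff_on_imp_continuous_on[OF cdiff_on_FD_cdiff_on[OF C open_ball]]
      by (simp add: continuous_on_eq_continuous_at)
    then obtain k where k: "0 < k"
      "\<forall>\<^sub>F x in at 0. \<forall>u. norm u \<le> k * norm (blinfun_apply (FD F x) u)"
      using eventually_bounded_below_blinfun[where A = "FD F" and ?z0.0 = 0] bij[of 0] bij_is_inj by auto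
    have "x0 \<noteq> 0" using x0 by auto
    then have "filterlim (\<lambda>t. t *\<^sub>R x0) (at 0) (at_right 0)"
      unfolding filterlim_at by (auto intro!: tendsto_eq_intros simp: eventually_at_filter)
    with k(2) have ev: "\<forall>\<^sub>F t in at_right 0. \<forall>u. norm u \<le> k * norm (blinfun_apply (FD F (t *\<^sub>R x0)) u)"
      by (auto simp: filterlim_iff)
    have small: "\<forall>\<^sub>F t in at_right (0::real). 0 < t \<and> t < 1"
      unfolding eventually_at by (rule exI[of _ 1]) (auto simp: dist_norm)
    define e0 where "e0 t = (1 / complex_of_real t ^ 3) *\<^sub>C (F (t *\<^sub>R x0)
      - (of_real t + b * of_real t ^ 2 + c * of_real t ^ 3) *\<^sub>C x0)" for t
    define e1 where "e1 t = (1 / complex_of_real t ^ 2) *\<^sub>C (blinfun_apply (FD F (t *\<^sub>R x0)) x0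
      - (1 + 2 * b * of_real t + 3 * c * of_real t ^ 2) *\<^sub>C x0)" for t
    \<comment> \<open>\<open>m\<close> is what remains of f - \<open>pt\<close> f' after
      cancellation up to t^3, divided by t^3, and \<open>n\<close> is \<open>pt\<close> divided by
      t.\<close>
    define m where "m t = - (a' * 3 * c + b' * 2 * b) * complex_of_real t - b' * 3 * c * of_real t ^ 2" for t
    define n where "n t = 1 + a' * complex_of_real t + b' * of_real t ^ 2" for t
    define R where "R t = m t *\<^sub>C x0 + e0 t - n t *\<^sub>C e1 t" for t
    have "(R \<longlongrightarrow> (0::complex) *\<^sub>C x0 + 0 - 1 *\<^sub>C 0) (at_right 0)"
      unfolding R_def
    proof (intro tendsto_intros)
      show "(m \<longlongrightarrow> 0) (at_right 0)" "(n \<longlongrightarrow> 1) (at_right 0)"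
        unfolding m_def n_def by (auto intro!: tendsto_eq_intros)
      show "(e0 \<longlongrightarrow> 0) (at_right 0)" "(e1 \<longlongrightarrow> 0) (at_right 0)"
        unfolding e0_def e1_def by (fact taylor)+
    qed
    then have R: "(R \<longlongrightarrow> 0) (at_right 0)" by simp
    show ?thesis
    proof (rule Lim_null_comparison)
      show "((\<lambda>t. k * norm (R t)) \<longlongrightarrow> 0) (at_right 0)"
        using tendsto_mult_right_zero[OF tendsto_norm_zero[OF R]] .
      show "\<forall>\<^sub>F t in at_right 0.
          norm ((1 / complex_of_real t ^ 3) *\<^sub>C (G (t *\<^sub>R x0) - pt t *\<^sub>C x0)) \<le> k * norm (R t)"
        using ev small
      proof eventually_elim
        case (elim t)
        define s where "s = complex_of_real t"
        have s: "s \<noteq> 0" using elim by (simp add: s_def)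
        have tb: "t *\<^sub>R x0 \<in> ball 0 1" using elim x0 by simp
        note lin = cdiff_on_FD(2)[OF C tb]
        have FG: "blinfun_apply (FD F (t *\<^sub>R x0)) (G (t *\<^sub>R x0)) = F (t *\<^sub>R x0)"
          unfolding G_def using bij[OF tb] by (simp add: bij_is_surj surj_f_inv_f)
        have FF: "F (t *\<^sub>R x0) = (s ^ 3) *\<^sub>C e0 t + (s + b * s ^ 2 + c * s ^ 3) *\<^sub>C x0"
          using s by (simp add: e0_def s_def)
        have AA: "blinfun_apply (FD F (t *\<^sub>R x0)) x0 = (s ^ 2) *\<^sub>C e1 t + (1 + 2 * b * s + 3 * c * s ^ 2) *\<^sub>C x0"
          using s by (simp add: e1_def s_def)
        have P: "pt t = s * n t" by (simp add: pt_def n_def s_def algebra_simps power2_eq_square power3_eq_cube)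
        have M: "s + b * s ^ 2 + c * s ^ 3 - pt t * (1 + 2 * b * s + 3 * c * s ^ 2) = s ^ 3 * m t"
          by (simp add: pt_def m_def s_def[symmetric] a'_def b'_def algebra_simps power2_eq_square power3_eq_cube)
        have "blinfun_apply (FD F (t *\<^sub>R x0)) (G (t *\<^sub>R x0) - pt t *\<^sub>C x0)
            = F (t *\<^sub>R x0) - pt t *\<^sub>C blinfun_apply (FD F (t *\<^sub>R x0)) x0"
          by (simp add: blinfun.diff_right lin FG)
        also have "\<dots> = (s ^ 3) *\<^sub>C e0 t - (pt t * s ^ 2) *\<^sub>C e1 t
            + (s + b * s ^ 2 + c * s ^ 3 - pt t * (1 + 2 * b * s + 3 * c * s ^ 2)) *\<^sub>C x0"
          unfolding FF AA scaleC_add_right scaleC_scaleC scaleC_diff_left by simp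
        also have "\<dots> = (s ^ 3) *\<^sub>C R t"
          unfolding M unfolding P R_def scaleC_add_right scaleC_diff_right scaleC_scaleC
          by (simp add: power2_eq_square power3_eq_cube ac_simps)
        finally have "blinfun_apply (FD F (t *\<^sub>R x0)) ((1 / s ^ 3) *\<^sub>C (G (t *\<^sub>R x0) - pt t *\<^sub>C x0)) = R t"
          using s by (simp add: lin)
        with elim(1) show ?case unfolding s_def by metis
      qed
    qed
  qed
  have "((\<lambda>t. (h (of_real t) - pt t) / of_real t ^ 3) \<longlongrightarrow> 0) (at_right 0)"
    using bounded_linear.tendsto[OF Tlin(1) lim] by (simp add: Tlin Tx h_def scaleR_scaleC)
  then have "cmod b' \<le> 2 * (1 - \<alpha>)"
    unfolding pt_def by (intro starlike_third_coeff_bound[OF \<alpha> hh region])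
  moreover have "cmod b' = 2 * cmod (c - b\<^sup>2)"
  proof -
    have "b' = - 2 * (c - b\<^sup>2)" by (simp add: b'_def)
    then show ?thesis by (simp only: norm_mult) simp
  qed
  ultimately show ?thesis unfolding A by simp
qed

section \<open>Sharpness\<close>

text \<open>Uniqueness of Taylor coefficients: the terms are peeled off in order, dividing by a
  further power of t each time. It serves to read off higher derivatives from an explicit
  expansion.\<close>

lemma vector_poly_coeffs_zero:
  fixes A B C :: "'a::real_normed_vector"
  assumes le: "\<forall>\<^sub>F t in at_right (0::real). norm (A + t *\<^sub>R B + t\<^sup>2 *\<^sub>R C) \<le> K * t ^ 3"
  shows "A = 0" "B = 0" "C = 0"
proof -
  have zero: "X = 0"
    if lim: "(f \<longlongrightarrow> X) (at_right 0)" and le: "\<forall>\<^sub>F t in at_right 0. norm (f t) \<le> K * t ^ Suc n"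
    for X :: 'a and f :: "real \<Rightarrow> 'a" and n
  proof -
    have "((\<lambda>t. K * t ^ Suc n) \<longlongrightarrow> 0) (at_right 0)"
      by (auto intro!: tendsto_eq_intros)
    from Lim_null_comparison[OF le this] show ?thesis
      using tendsto_unique[OF _ lim] by force
  qed
  have pos: "\<forall>\<^sub>F t in at_right (0::real). 0 < t"
    by (simp add: eventually_at_right_less)
  show A: "A = 0"
    by (rule zero[of "\<lambda>t. A + t *\<^sub>R B + t\<^sup>2 *\<^sub>R C" A 2])
       (use le in \<open>auto intro!: tendsto_eq_intros simp: numeral_eq_Suc\<close>)
  show B: "B = 0"
  proof (rule zero[of "\<lambda>t. B + t *\<^sub>R C" B 1])
    show "\<forall>\<^sub>F t in at_right 0. norm (B + t *\<^sub>R C) \<le> K * t ^ Suc 1"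
      using le pos
    proof eventually_elim
      case (elim t)
      have "t *\<^sub>R B + t\<^sup>2 *\<^sub>R C = t *\<^sub>R (B + t *\<^sub>R C)"
        by (simp add: scaleR_add_right power2_eq_square)
      with elim have "t * norm (B + t *\<^sub>R C) \<le> t * (K * t ^ Suc 1)"
        by (simp add: A power3_eq_cube mult.commute mult.left_commute)
      then show ?case using elim(2) by (rule mult_left_le_imp_le)
    qed
  qed (auto intro!: tendsto_eq_intros)
  show "C = 0"
  proof (rule zero[of "\<lambda>t. C" C 0])
    show "\<forall>\<^sub>F t in at_right 0. norm C \<le> K * t ^ Suc 0"
      using le pos
    proof eventually_elim
      case (elim t)
      then have "t\<^sup>2 * norm C \<le> t\<^sup>2 * (K * t ^ Suc 0)"
        by (simp add: A B power3_eq_cube power2_eq_square mult.commute mult.left_commute)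
      then show ?case by (rule mult_left_le_imp_le) (use elim(2) in simp)
    qed
  qed simp
qed

section \<open>Maps of the form \<phi>(T x) x\<close>

locale scalar_multiplier_map =
  fixes T :: "'a::complex_banach \<Rightarrow> complex" and \<phi> \<phi>' :: "complex \<Rightarrow> complex"
  assumes T_linear: "bounded_complex_linear T"
    and T_le: "cmod (T x) \<le> norm x"
    and \<phi>_deriv: "cmod z < 1 \<Longrightarrow> (\<phi> has_field_derivative \<phi>' z) (at z)"
    and \<phi>_nz: "cmod z < 1 \<Longrightarrow> \<phi> z \<noteq> 0"
    and \<psi>_nz: "cmod z < 1 \<Longrightarrow> \<phi> z + z * \<phi>' z \<noteq> 0"
    and \<phi>_0: "\<phi> 0 = 1"
begin

lemmas T_simps = bounded_complex_linearD[OF T_linear]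

definition F :: "'a \<Rightarrow> 'a"
  where "F x = \<phi> (T x) *\<^sub>C x"

text \<open>A multiple of the identity plus an operator of rank at most one with range in the line
  through x. It is invertible when \<phi>(z) and the derivative of z \<phi>(z) are nonzero at z = T
  x, which are the two nonvanishing conditions of the locale.\<close>

definition DF :: "'a \<Rightarrow> 'a \<Rightarrow> 'a"
  where "DF x v = \<phi> (T x) *\<^sub>C v + (\<phi>' (T x) * T v) *\<^sub>C x"

lemma F_has_derivative:
  assumes "norm x < 1"
  shows "(F has_derivative DF x) (at x)"
proof -
  have "cmod (T x) < 1" using T_le[of x] assms by linarith
  then have "(\<phi> has_derivative (*) (\<phi>' (T x))) (at (T x))"
    using \<phi>_deriv by (simp add: has_field_derivative_def)
  from has_derivative_compose[OF bounded_linear_imp_has_derivative[OF T_simps(1)] this]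
  have "((\<lambda>x. \<phi> (T x)) has_derivative (\<lambda>v. \<phi>' (T x) * T v)) (at x)" .
  from bounded_bilinear.FDERIV[OF bounded_bilinear_scaleC this has_derivative_ident]
  show ?thesis unfolding F_def DF_def .
qed

lemma FD_F: "norm x < 1 \<Longrightarrow> blinfun_apply (FD F x) = DF x"
  by (metis FD_works F_has_derivative differentiable_def has_derivative_unique)

lemma cdiff_F: "cdiff_on F (ball 0 1)"
  by (rule cdiff_onI[where D = DF])
     (auto simp: F_has_derivative DF_def T_simps scaleC_add_right mult_ac)

text \<open>The Sherman-Morrison formula for the inverse of a multiple of the identity plus a
  rank-one operator.\<close>

definition DF_inv :: "'a \<Rightarrow> 'a \<Rightarrow> 'a"
  where "DF_inv x u = (1 / \<phi> (T x)) *\<^sub>C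
    (u - (\<phi>' (T x) / (\<phi> (T x) + T x * \<phi>' (T x)) * T u) *\<^sub>C x)"

lemma DF_inverse:
  assumes "norm x < 1"
  shows "DF x (DF_inv x u) = u" "DF_inv x (DF x v) = v"
proof -
  have z: "cmod (T x) < 1" using T_le[of x] assms by linarith
  define a b where "a = \<phi> (T x)" and "b = \<phi>' (T x)"
  have nz: "a \<noteq> 0" "a + T x * b \<noteq> 0"
    unfolding a_def b_def by (fact \<phi>_nz[OF z] \<psi>_nz[OF z])+
  have "T (DF_inv x u) = T u / (a + T x * b)"
    unfolding DF_inv_def a_def[symmetric] b_def[symmetric]
    using nz by (simp add: T_simps divide_simps) (simp add: algebra_simps)
  then have "DF x (DF_inv x u) = a *\<^sub>C (1 / a) *\<^sub>C (u - (b / (a + T x * b) * T u) *\<^sub>C x)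
      + (b * (T u / (a + T x * b))) *\<^sub>C x"
    by (simp only: DF_def) (simp only: DF_inv_def a_def[symmetric] b_def[symmetric])
  also have "\<dots> = u" using nz by simp
  finally show "DF x (DF_inv x u) = u" .
  have "T (DF x v) = (a + T x * b) * T v"
    by (simp add: DF_def T_simps a_def b_def algebra_simps)
  then have "DF_inv x (DF x v) = (1 / a) *\<^sub>C (a *\<^sub>C v + (b * T v) *\<^sub>C x - (b * T v) *\<^sub>C x)"
    using nz by (simp add: DF_inv_def) (simp add: DF_def a_def b_def)
  also have "\<dots> = v" using nz by simp
  finally show "DF_inv x (DF x v) = v" .
qed

lemma inv_FD_F:
  assumes "norm x < 1"
  shows "bij (blinfun_apply (FD F x))" "inv (blinfun_apply (FD F x)) = DF_inv x"
proof -
  have "DF x \<circ> DF_inv x = id" "DF_inv x \<circ> DF x = id"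
    using DF_inverse[OF assms] by (auto simp: fun_eq_iff)
  then show "bij (blinfun_apply (FD F x))" "inv (blinfun_apply (FD F x)) = DF_inv x"
    unfolding FD_F[OF assms] by (auto intro: o_bij inv_unique_comp)
qed

lemma locally_biholomorphic_F: "locally_biholomorphic F"
proof -
  have "bounded_linear (DF_inv x)" for x
    unfolding DF_inv_def
    by (intro bounded_linear_compose[OF bounded_linear_scaleC_right] bounded_linear_sub
        bounded_linear_ident bounded_linear_compose[OF bounded_linear_scaleC_left]
        bounded_linear_const_mult T_simps(1))
  then show ?thesis
    using cdiff_F inv_FD_F
    by (simp add: locally_biholomorphic_def holomorphic_ball_def cdiff_on_def)
qed

lemma normalized_F: "normalized F"
  unfolding normalized_def
  by (auto intro!: blinfun_eqI simp: FD_F DF_def F_def T_simps \<phi>_0)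

text \<open>The line through x is invariant under DF(x), which acts on it as multiplication by
  \<phi>(z) + z \<phi>'(z) with z = T x. Hence the preimage of F(x) is a multiple of x, and the
  starlikeness condition reduces to one on the scalar T x.\<close>

lemma inv_FD_F_F:
  assumes "norm x < 1"
  shows "inv (blinfun_apply (FD F x)) (F x) = (\<phi> (T x) / (\<phi> (T x) + T x * \<phi>' (T x))) *\<^sub>C x"
proof -
  have z: "cmod (T x) < 1" using T_le[of x] assms by linarith
  define c where "c = \<phi> (T x) / (\<phi> (T x) + T x * \<phi>' (T x))"
  have "\<phi> (T x) * c + \<phi>' (T x) * (c * T x) = c * (\<phi> (T x) + T x * \<phi>' (T x))"
    by (simp add: algebra_simps)
  also have "\<dots> = \<phi> (T x)" using \<psi>_nz[OF z] by (simp add: c_def)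
  finally have "F x = DF x (c *\<^sub>C x)"
    by (simp add: DF_def F_def T_simps flip: scaleC_add_left)
  then show ?thesis
    using DF_inverse(2)[OF assms] by (simp add: inv_FD_F[OF assms] c_def)
qed

text \<open>Instead of differentiating F four times, its Taylor polynomial P along t v is compared
  with the polynomial Q obtained from the given expansion of \<phi>. Both approximate F(t v) with
  error of order t^5 and have the same linear term, so the coefficients of t^2, t^3 and t^4 must
  agree.\<close>

lemma diag_derivatives:
  assumes K: "\<And>z. cmod z \<le> r \<Longrightarrow> cmod (\<phi> z - (1 + b * z\<^sup>2)) \<le> K * cmod z ^ 4" and "0 < r"
  shows "D2_diag F v = 0" "D3_diag F v = (6 * b * (T v)\<^sup>2) *\<^sub>C v" "D4_diag F v = 0"
proof -
  obtain K' d where d: "0 < d" and taylor: "\<forall>t\<in>{0..d}.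
      norm (F (t *\<^sub>R v) - (F 0 + t *\<^sub>R blinfun_apply (FD F 0) v + (t\<^sup>2 / 2) *\<^sub>R D2_diag F v
        + (t ^ 3 / 6) *\<^sub>R D3_diag F v + (t ^ 4 / 24) *\<^sub>R D4_diag F v)) \<le> K' * t ^ 5"
    by (rule cdiff_on_taylor[OF cdiff_F, of v], rule that; assumption)
  have F0: "F 0 = 0" "blinfun_apply (FD F 0) v = v"
    using normalized_F by (simp_all add: normalized_def)
  define A B C where "A = (1 / 2) *\<^sub>R D2_diag F v"
    and "B = (1 / 6) *\<^sub>R D3_diag F v - (b * (T v)\<^sup>2) *\<^sub>C v" and "C = (1 / 24) *\<^sub>R D4_diag F v"
  define L where "L = K' + K * cmod (T v) ^ 4 * norm v"
  have "norm (A + t *\<^sub>R B + t\<^sup>2 *\<^sub>R C) \<le> L * t ^ 3"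
    if t: "0 < t" "t \<le> d" "t * norm v \<le> r" for t
  proof -
    define P where "P = t *\<^sub>R v + (t\<^sup>2 / 2) *\<^sub>R D2_diag F v
        + (t ^ 3 / 6) *\<^sub>R D3_diag F v + (t ^ 4 / 24) *\<^sub>R D4_diag F v"
    define Q where "Q = (complex_of_real t * (1 + b * (of_real t * T v)\<^sup>2)) *\<^sub>C v"
    have z: "cmod (of_real t * T v) \<le> r"
      using order_trans[OF mult_left_mono[OF T_le[of v], of t], of r] t by (simp add: norm_mult)
    have "F (t *\<^sub>R v) - Q = (of_real t * (\<phi> (of_real t * T v) - (1 + b * (of_real t * T v)\<^sup>2))) *\<^sub>C v"
      unfolding Q_def right_diff_distrib scaleC_diff_left
      by (simp add: F_def T_simps scaleR_scaleC scaleR_conv_of_real mult.commute)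
    then have "norm (F (t *\<^sub>R v) - Q)
        = t * cmod (\<phi> (of_real t * T v) - (1 + b * (of_real t * T v)\<^sup>2)) * norm v"
      using t by (simp add: norm_mult)
    also have "\<dots> \<le> t * (K * cmod (of_real t * T v) ^ 4) * norm v"
      using t by (intro mult_right_mono mult_left_mono K z) auto
    also have "\<dots> = K * cmod (T v) ^ 4 * norm v * t ^ 5"
      using t by (simp add: norm_mult power_mult_distrib eval_nat_numeral)
    finally have 1: "norm (F (t *\<^sub>R v) - Q) \<le> K * cmod (T v) ^ 4 * norm v * t ^ 5" .
    have 2: "norm (F (t *\<^sub>R v) - P) \<le> K' * t ^ 5"
      using bspec[OF taylor, of t] t by (simp add: F0 P_def)
    have "norm (P - Q) \<le> L * t ^ 5"
      using norm_triangle_ineq4[of "F (t *\<^sub>R v) - Q" "F (t *\<^sub>R v) - P"] 1 2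
      by (simp add: L_def algebra_simps)
    moreover have "P - Q = (t\<^sup>2) *\<^sub>R (A + t *\<^sub>R B + t\<^sup>2 *\<^sub>R C)"
    proof -
      have Q: "Q = t *\<^sub>R v + (t ^ 3) *\<^sub>R (b * (T v)\<^sup>2) *\<^sub>C v"
        by (simp add: Q_def scaleR_scaleC power_mult_distrib ring_distribs power3_eq_cube
            power2_eq_square mult_ac flip: scaleC_add_left)
      show ?thesis
        unfolding P_def Q A_def B_def C_def
        by (simp add: scaleR_add_right scaleR_diff_right eval_nat_numeral field_simps)
    qed
    ultimately have "t\<^sup>2 * norm (A + t *\<^sub>R B + t\<^sup>2 *\<^sub>R C) \<le> t\<^sup>2 * (L * t ^ 3)"
      by (simp add: eval_nat_numeral mult_ac)
    then show ?thesis by (rule mult_left_le_imp_le) (use t in simp)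
  qed
  moreover have "\<forall>\<^sub>F t in at_right (0::real). 0 < t \<and> t \<le> d \<and> t * norm v \<le> r"
  proof -
    define e where "e = min d (r / (norm v + 1))"
    have "0 < e" using d \<open>0 < r\<close> by (simp add: e_def add_nonneg_pos)
    moreover have "t \<le> d \<and> t * norm v \<le> r" if "0 < t" "t < e" for t
    proof -
      have "t * norm v \<le> t * (norm v + 1)" using that by simp
      also have "\<dots> \<le> r" using that by (simp add: e_def less_divide_eq add_nonneg_pos)
      finally show ?thesis using that by (simp add: e_def)
    qed
    ultimately show ?thesis
      unfolding eventually_at by (intro exI[of _ e]) (auto simp: dist_norm)
  qed
  ultimately have "\<forall>\<^sub>F t in at_right (0::real). norm (A + t *\<^sub>R B + t\<^sup>2 *\<^sub>R C) \<le> L * t ^ 3"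
    by (auto elim: eventually_mono)
  from vector_poly_coeffs_zero[OF this] have ABC: "A = 0" "B = 0" "C = 0" .
  from ABC(1,3) show "D2_diag F v = 0" "D4_diag F v = 0"
    by (simp_all add: A_def C_def)
  have "D3_diag F v = 6 *\<^sub>R (B + (b * (T v)\<^sup>2) *\<^sub>C v)"
    by (simp add: B_def)
  with ABC(2) show "D3_diag F v = (6 * b * (T v)\<^sup>2) *\<^sub>C v"
    by (simp add: scaleR_scaleC mult.assoc)
qed

lemma radial_terms_F:
  assumes K: "\<And>z. cmod z \<le> r \<Longrightarrow> cmod (\<phi> z - (1 + b * z\<^sup>2)) \<le> K * cmod z ^ 4" and "0 < r"
  shows "radial_terms F (\<lambda>k x. if k = 2 then b * (T x)\<^sup>2 else 0)"
proof -
  have 0: "homogeneous_polynomial k (\<lambda>x::'a. 0)" for k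
    unfolding homogeneous_polynomial_def
    by (rule exI[of _ "\<lambda>_. 0"]) (simp add: complex_linear_def)
  have "homogeneous_polynomial 2 (\<lambda>x. b * (T x)\<^sup>2)"
    unfolding homogeneous_polynomial_def
    by (rule exI[of _ "\<lambda>xs. b * prod_list (map T xs)"])
       (auto simp: complex_linear_def T_simps algebra_simps numeral_eq_Suc)
  with 0 show ?thesis
    by (auto simp: radial_terms_def diag_derivatives[OF K \<open>0 < r\<close>] fact_numeral scaleR_scaleC)
qed

end

text \<open>The Mobius map s -> (1 - s) / (1 + (1 - 2\<alpha>) s) is its own inverse, so the unit
  disc is carried back into the starlike region. Multiplied by the squared modulus of the
  denominator, the slack in the region inequality is (1 - \<alpha>) (1 - |s|^2).\<close>

lemma mobius_starlike_region:
  fixes s :: complex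
  assumes \<alpha>: "0 \<le> \<alpha>" "\<alpha> < 1" and s: "cmod s < 1"
  shows "1 + (1 - 2 * of_real \<alpha>) * s \<noteq> 0"
    and "\<alpha> * (cmod ((1 - s) / (1 + (1 - 2 * of_real \<alpha>) * s)))\<^sup>2 < Re ((1 - s) / (1 + (1 - 2 * of_real \<alpha>) * s))"
proof -
  define q where "q = 1 + (1 - 2 * complex_of_real \<alpha>) * s"
  have "cmod ((1 - 2 * complex_of_real \<alpha>) * s) < 1"
  proof -
    have "1 - 2 * complex_of_real \<alpha> = complex_of_real (1 - 2 * \<alpha>)" by simp
    then have "cmod ((1 - 2 * complex_of_real \<alpha>) * s) = \<bar>1 - 2 * \<alpha>\<bar> * cmod s"
      by (simp only: norm_mult norm_of_real)
    also have "\<dots> \<le> 1 * cmod s" using \<alpha> by (intro mult_right_mono) auto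
    finally show ?thesis using s by simp
  qed
  then have q: "q \<noteq> 0"
    unfolding q_def by (metis add_eq_0_iff less_irrefl norm_minus_cancel norm_one)
  then show "1 + (1 - 2 * of_real \<alpha>) * s \<noteq> 0" by (simp add: q_def)
  have "\<alpha> * (cmod (1 - s))\<^sup>2 < Re ((1 - s) * cnj q)"
  proof -
    have "Re ((1 - s) * cnj q) - \<alpha> * (cmod (1 - s))\<^sup>2 = (1 - \<alpha>) * (1 - (cmod s)\<^sup>2)"
      unfolding cmod_power2 q_def by (simp add: power2_eq_square algebra_simps)
    also have "\<dots> > 0" using \<alpha> s by (simp add: power_less_one_iff)
    finally show ?thesis by simp
  qed
  then have "\<alpha> * (cmod (1 - s))\<^sup>2 / (cmod q)\<^sup>2 < Re ((1 - s) * cnj q) / (cmod q)\<^sup>2"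
    using q by (intro divide_strict_right_mono) auto
  also have "Re ((1 - s) * cnj q) / (cmod q)\<^sup>2 = Re ((1 - s) / q)"
    unfolding complex_div_cnj[of "1 - s" q] by (simp flip: of_real_power)
  finally show "\<alpha> * (cmod ((1 - s) / (1 + (1 - 2 * of_real \<alpha>) * s)))\<^sup>2 < Re ((1 - s) / (1 + (1 - 2 * of_real \<alpha>) * s))"
    by (simp add: q_def norm_divide power_divide)
qed

text \<open>Splitting off a factor s twice leaves a function holomorphic in the unit disc, hence
  bounded on the closed disc of radius 1/2; that bound is K. The coefficient b is the derivative of
  the power at 0.\<close>

lemma one_minus_powr_expansion:
  fixes b :: complex
  obtains K where "\<And>s. cmod s \<le> 1 / 2 \<Longrightarrow> cmod ((1 - s) powr (- b) - (1 + b * s)) \<le> K * cmod s ^ 2"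
proof -
  define u where "u s = (1 - s) powr (- b)" for s
  have nonpos: "1 - s \<notin> \<real>\<^sub>\<le>\<^sub>0" if "cmod s < 1" for s
    using that complex_Re_le_cmod[of s] by (auto simp: complex_nonpos_Reals_iff)
  have du: "(u has_field_derivative b * (1 - s) powr (- b - 1)) (at s)" if "cmod s < 1" for s
    unfolding u_def using nonpos[OF that]
    by (auto intro!: derivative_eq_intros)
  have u: "u holomorphic_on ball 0 1"
    by (rule holomorphic_onI) (metis du field_differentiable_at_within field_differentiable_def mem_ball_0)
  have "(\<lambda>s. u s - u 0) holomorphic_on ball 0 1" by (intro holomorphic_intros u)
  then obtain g where g: "g holomorphic_on ball 0 1" "\<And>s. cmod s < 1 \<Longrightarrow> u s - u 0 = s * g s"
      "deriv (\<lambda>s. u s - u 0) 0 = g 0"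
    by (rule Schwarz3) auto
  have "((\<lambda>s. u s - u 0) has_field_derivative b) (at 0)"
    using du[of 0] by (auto intro!: derivative_eq_intros)
  then have g0: "g 0 = b" using g(3) DERIV_imp_deriv by metis
  have "(\<lambda>s. g s - g 0) holomorphic_on ball 0 1" by (intro holomorphic_intros g)
  then obtain k where k: "k holomorphic_on ball 0 1" "\<And>s. cmod s < 1 \<Longrightarrow> g s - g 0 = s * k s"
    by (rule Schwarz3) auto
  have "continuous_on (cball 0 (1/2)) k"
    by (rule continuous_on_subset[OF holomorphic_on_imp_continuous_on[OF k(1)]]) auto
  then have "bounded (k ` cball 0 (1/2))"
    by (intro compact_imp_bounded compact_continuous_image) auto
  then obtain K where K: "\<forall>y\<in>k ` cball 0 (1/2). cmod y \<le> K"
    unfolding bounded_iff by blast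
  show thesis
  proof (rule that)
    fix s :: complex assume s: "cmod s \<le> 1 / 2"
    have "u 0 = 1" by (simp add: u_def)
    then have "u s = 1 + s * g s" using g(2)[of s] s by (simp add: diff_eq_eq add.commute)
    moreover have "g s = b + s * k s" using k(2)[of s] g0 s by (simp add: diff_eq_eq add.commute)
    ultimately have "u s - (1 + b * s) = k s * s\<^sup>2" by (simp add: algebra_simps power2_eq_square)
    then have "cmod (u s - (1 + b * s)) = cmod (k s) * cmod s ^ 2" by (simp add: norm_mult norm_power)
    also have "\<dots> \<le> K * cmod s ^ 2" using K s by (intro mult_right_mono) auto
    finally show "cmod ((1 - s) powr (- b) - (1 + b * s)) \<le> K * cmod s ^ 2" by (simp add: u_def)
  qed
qed

text \<open>The even Schwarz bound is attained when the Mobius image is z^2, that is, when \<phi> /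
  (\<phi> + z \<phi>') = (1 - z^2) / (1 + (1 - 2\<alpha>) z^2). This amounts to \<phi>' / \<phi> = 2
  (1 - \<alpha>) z / (1 - z^2), whose solution with \<phi>(0) = 1 is the power chosen here.\<close>

lemma starlike_coefficient_bound_sharp:
  fixes x0 :: "'a::complex_banach"
  assumes \<alpha>: "0 \<le> \<alpha>" "\<alpha> < 1" and x0: "norm x0 = 1" and T: "T \<in> support_functionals x0"
  obtains F H where "locally_biholomorphic F" "radial_terms F H" "F \<in> starlike_mappings \<alpha>"
    "cmod (A3 F x0 T - (A2 F x0 T)\<^sup>2) = 1 - \<alpha>"
proof -
  define b where "b = complex_of_real (1 - \<alpha>)"
  define \<phi> where "\<phi> z = (1 - z\<^sup>2) powr (- b)" for z
  define \<phi>' where "\<phi>' z = \<phi> z * (2 * b * z / (1 - z\<^sup>2))" for z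
  have sq: "cmod (z\<^sup>2) < 1" if "cmod z < 1" for z
    using that by (simp add: norm_power power_less_one_iff)
  have nonpos: "1 - z\<^sup>2 \<notin> \<real>\<^sub>\<le>\<^sub>0" if "cmod z < 1" for z
    using sq[OF that] complex_Re_le_cmod[of "z\<^sup>2"] by (auto simp: complex_nonpos_Reals_iff)
  then have nz: "1 - z\<^sup>2 \<noteq> 0" if "cmod z < 1" for z
    using that by force
  have \<phi>_nz: "\<phi> z \<noteq> 0" if "cmod z < 1" for z
    using nz[OF that] by (simp add: \<phi>_def)
  have \<psi>: "\<phi> z + z * \<phi>' z = \<phi> z * ((1 + (1 - 2 * of_real \<alpha>) * z\<^sup>2) / (1 - z\<^sup>2))" if "cmod z < 1" for z
    using nz[OF that] by (simp add: \<phi>'_def b_def divide_simps) (simp add: algebra_simps power2_eq_square)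
  have bT: "bounded_complex_linear T" "onorm T = 1" "T x0 = 1"
    using T x0 by (auto simp: support_functionals_def)
  interpret scalar_multiplier_map T \<phi> \<phi>'
  proof
    show "bounded_complex_linear T" by (fact bT)
    show "cmod (T x) \<le> norm x" for x
      using onorm[OF bounded_complex_linearD(1)[OF bT(1)], of x] bT(2) by simp
    show "(\<phi> has_field_derivative \<phi>' z) (at z)" if "cmod z < 1" for z
    proof -
      have "(\<phi> has_field_derivative - b * (1 - z\<^sup>2) powr (- b - 1) * (- (2 * z))) (at z)"
        unfolding \<phi>_def using nonpos[OF that] by (auto intro!: derivative_eq_intros)
      moreover have "(1 - z\<^sup>2) powr (- b - 1) = \<phi> z / (1 - z\<^sup>2)"
        using nz[OF that] by (simp add: \<phi>_def powr_diff)
      ultimately show ?thesis by (simp add: \<phi>'_def mult_ac)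
    qed
    show "\<phi> z \<noteq> 0" if "cmod z < 1" for z by (rule \<phi>_nz[OF that])
    show "\<phi> z + z * \<phi>' z \<noteq> 0" if "cmod z < 1" for z
      unfolding \<psi>[OF that] using \<phi>_nz[OF that] nz[OF that] mobius_starlike_region(1)[OF \<alpha> sq[OF that]]
      by simp
    show "\<phi> 0 = 1" by (simp add: \<phi>_def)
  qed
  have "F \<in> starlike_mappings \<alpha>"
    unfolding starlike_mappings_region[OF \<alpha> normalized_F locally_biholomorphic_F]
  proof (intro ballI)
    fix x S assume x: "x \<in> ball 0 1 - {0::'a}" and S: "S \<in> support_functionals x"
    have x1: "norm x < 1" using x by simp
    have z: "cmod (T x) < 1" using T_le[of x] x1 by linarith
    \<comment> \<open>As DF(x)^-1 F(x) is a multiple of x, the value S x = norm x is all that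
      enters, so every support functional at x gives the same condition.\<close>
    have Sx: "S (c *\<^sub>C x) = c * norm x" for c
      using S by (simp add: support_functionals_def bounded_complex_linearD)
    have "\<phi> (T x) / (\<phi> (T x) + T x * \<phi>' (T x)) = (1 - (T x)\<^sup>2) / (1 + (1 - 2 * of_real \<alpha>) * (T x)\<^sup>2)"
      unfolding \<psi>[OF z] using \<phi>_nz[OF z] by simp
    then have "S (inv (blinfun_apply (FD F x)) (F x)) / norm x
        = (1 - (T x)\<^sup>2) / (1 + (1 - 2 * of_real \<alpha>) * (T x)\<^sup>2)"
      using x by (simp only: inv_FD_F_F[OF x1] Sx) simp
    then show "let w = S (inv (blinfun_apply (FD F x)) (F x)) / norm x in \<alpha> * (cmod w)\<^sup>2 < Re w"
      using mobius_starlike_region(2)[OF \<alpha> sq[OF z]] by (simp only: Let_def)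
  qed
  moreover obtain K where K: "\<And>s. cmod s \<le> 1 / 2 \<Longrightarrow> cmod ((1 - s) powr (- b) - (1 + b * s)) \<le> K * cmod s ^ 2"
    using one_minus_powr_expansion by blast
  \<comment> \<open>Substituting s = z^2 doubles the order of the error and stays within the disc
    where K is valid, as |z| \<le> 1/2 gives |z^2| \<le> 1/4.\<close>
  have expansion: "cmod (\<phi> z - (1 + b * z\<^sup>2)) \<le> K * cmod z ^ 4" if "cmod z \<le> 1 / 2" for z
  proof -
    have "cmod (z\<^sup>2) \<le> (1 / 2)\<^sup>2" unfolding norm_power by (rule power_mono[OF that]) simp
    then have "cmod (z\<^sup>2) \<le> 1 / 2" by (simp add: power2_eq_square)
    from K[OF this] show ?thesis by (simp add: \<phi>_def norm_power flip: power_mult)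
  qed
  have "radial_terms F (\<lambda>k x. if k = 2 then b * (T x)\<^sup>2 else 0)"
    by (rule radial_terms_F[where r = "1 / 2" and K = K]) (simp_all add: expansion)
  \<comment> \<open>As T x0 = 1, the formulas for the derivatives give A2 = 0 and A3 = b.\<close>
  moreover have "A3 F x0 T - (A2 F x0 T)\<^sup>2 = b"
    using diag_derivatives(1,2)[where r = "1 / 2" and K = K and b = b and v = x0] expansion
    by (simp add: A3_def A2_def T_simps bT(3) fact_numeral)
  then have "cmod (A3 F x0 T - (A2 F x0 T)\<^sup>2) = 1 - \<alpha>"
    using \<alpha> by (simp add: b_def del: of_real_diff)
  ultimately show thesis
    using that locally_biholomorphic_F by blast
qed

theorem theorem3p4:
  fixes \<alpha> :: real
  assumes "\<exists>x::'a::complex_banach. x \<noteq> 0"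
    and "0 \<le> \<alpha>" and "\<alpha> < 1"
  shows "(\<forall>(F :: 'a \<Rightarrow> 'a) H.
            locally_biholomorphic F \<longrightarrow> radial_terms F H \<longrightarrow> F \<in> starlike_mappings \<alpha> \<longrightarrow>
            (\<forall>x0 T. norm x0 = 1 \<longrightarrow> T \<in> support_functionals x0 \<longrightarrow>
              cmod (A3 F x0 T - (A2 F x0 T)\<^sup>2) \<le> 1 - \<alpha>))
       \<and> (\<exists>(F :: 'a \<Rightarrow> 'a) H x0 T.
            locally_biholomorphic F \<and> radial_terms F H \<and> F \<in> starlike_mappings \<alpha> \<and>
            norm x0 = 1 \<and> T \<in> support_functionals x0 \<and>
            cmod (A3 F x0 T - (A2 F x0 T)\<^sup>2) = 1 - \<alpha>)"
proof (intro conjI allI impI)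
  show "cmod (A3 F x0 T - (A2 F x0 T)\<^sup>2) \<le> 1 - \<alpha>"
    if "radial_terms F H" "F \<in> starlike_mappings \<alpha>" "norm x0 = 1" "T \<in> support_functionals x0"
    for F :: "'a \<Rightarrow> 'a" and H x0 T
    using starlike_coefficient_bound[OF assms(2,3) that(2,1,3,4)] .
  obtain x :: 'a where "x \<noteq> 0" using assms(1) by blast
  define x0 where "x0 = x /\<^sub>R norm x"
  have x0: "norm x0 = 1" using \<open>x \<noteq> 0\<close> by (simp add: x0_def)
  then have "x0 \<noteq> 0" by auto
  then obtain T where T: "T \<in> support_functionals x0"
    by (rule support_functionals_nonempty)
  obtain F :: "'a \<Rightarrow> 'a" and H where "locally_biholomorphic F" "radial_terms F H"
      "F \<in> starlike_mappings \<alpha>" "cmod (A3 F x0 T - (A2 F x0 T)\<^sup>2) = 1 - \<alpha>"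
    by (rule starlike_coefficient_bound_sharp[OF assms(2,3) x0 T], rule that; assumption)
  with x0 T show "\<exists>(F :: 'a \<Rightarrow> 'a) H x0 T.
            locally_biholomorphic F \<and> radial_terms F H \<and> F \<in> starlike_mappings \<alpha> \<and>
            norm x0 = 1 \<and> T \<in> support_functionals x0 \<and>
            cmod (A3 F x0 T - (A2 F x0 T)\<^sup>2) = 1 - \<alpha>"
    by blast
qed

end
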